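(* Let $R$ be a polynomial ring over $\Bbbk$, $S$ a quotient of $R$, $(F_\bullet,d)$ a free resolution of $S$ as an $R$-module with $F_0=R$ and only finitely many non-zero terms, and let $P_\bullet$ be the commutative graded algebra constructed from $F_\bullet$ as described in the context. Let $i\ge1$. Suppose that for all $j\le i$ we have $R$-linear maps $\partial_j:P_j\to P_{j-1}$ of the form (A) satisfying the graded Leibniz rule (B) and the condition (C), all stated in the context (starting from $\partial_0=0$, $\partial_1=d_1$). (1) There exists $\rho_{i+1}:P_i^{\mathrm{old}}\to F_i$ satisfying $d_i\rho_{i+1}=\rho_i\gamma_i+\alpha_i$. (2) After choosing such $\rho_{i+1}$, there is a unique map $\partial_{i+1}$ of the form (A) satisfying (B) and (C) for $j=i+1$. (3) The differential $\partial$ for $P_\bullet$ obtained via induction yields a Koszul-Tate resolution of $S$, that is, $H_k(P_\bullet)\cong S$ for $k=0$ and $H_k(P_\bullet)=0$ otherwise.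
   Context: $\Bbbk$ is a field of characteristic zero; homological grading is used ($d$ lowers degree by one). A Koszul-Tate resolution of $S$ is a non-negatively graded commutative differential graded algebra, free as a graded-commutative algebra after forgetting the differential, together with a quasi-isomorphism to $S$ (placed in degree $0$). Construction of $P_\bullet$ as a commutative graded algebra: let $P(0)=R$ in degree $0$, with $P_0=R=F_0$ and $P_0^{\mathrm{old}}=0$. Inductively for $i\ge0$, set $P_{i+1}^{\mathrm{new}}=F_{i+1}\oplus P_i^{\mathrm{old}}$; let $P(i+1)$ be the graded symmetric algebra over $R$ of the graded free $R$-module $\bigoplus_{1\le j\le i+1}P_j^{\mathrm{new}}$ (elements of $P_j^{\mathrm{new}}$ in degree $j$); and set $P_{i+1}^{\mathrm{old}}=P(i)_{i+1}$, the degree $i+1$ part of $P(i)$. Then $P(i)\subseteq P(i+1)$, and $P_\bullet=\bigcup_iP(i)$, so that for $j\ge1$ $$P_j=P_j^{\mathrm{new}}\oplus P_j^{\mathrm{old}}=F_j\oplus P_{j-1}^{\mathrm{old}}\oplus P_j^{\mathrm{old}}.$$ (A) The form of $\partial_j:F_j\oplus P_{j-1}^{\mathrm{old}}\oplus P_j^{\mathrm{old}}\to F_{j-1}\oplus P_{j-2}^{\mathrm{old}}\oplus P_{j-1}^{\mathrm{old}}$ is $$\partial_j=\begin{pmatrix}d_j&-\rho_j&\alpha_j\\0&-\gamma_{j-1}&\beta_j\\0&\mathrm{Id}&\gamma_j\end{pmatrix}$$ with $\rho_j:P_{j-1}^{\mathrm{old}}\to F_{j-1}$, $\alpha_j:P_j^{\mathrm{old}}\to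 F_{j-1}$, $\beta_j:P_j^{\mathrm{old}}\to P_{j-2}^{\mathrm{old}}$, $\gamma_j:P_j^{\mathrm{old}}\to P_{j-1}^{\mathrm{old}}$, where $\gamma_{j-1}$ is the map occurring in $\partial_{j-1}$. (B) $\partial_j(yz)=\partial_k(y)z+(-1)^ky\,\partial_{j-k}(z)$ for all $y\in P_k$, $z\in P_{j-k}$. (C) $\partial_{j-1}\partial_j=0$. *)

theory Defs
  imports "HOL-Library.Poly_Mapping" "HOL-Library.Multiset" "HOL-Library.FuncSet"
begin

section \<open>Modules of finitely supported functions\<close>

text \<open>
  A free \<open>R\<close>-module with basis \<open>B\<close> is the set of finitely supported functions into \<open>R\<close> whose
  support lies in \<open>B\<close>.
\<close>

definition free_mod :: "'b set \<Rightarrow> ('b \<Rightarrow>\<^sub>0 'r::comm_ring_1) set" where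
  "free_mod B = {x. Poly_Mapping.keys x \<subseteq> B}"

definition scale :: "'r::comm_ring_1 \<Rightarrow> ('b \<Rightarrow>\<^sub>0 'r) \<Rightarrow> ('b \<Rightarrow>\<^sub>0 'r)" where
  "scale c x = Poly_Mapping.map ((*) c) x"

definition linear_on ::
  "('a \<Rightarrow>\<^sub>0 'r::comm_ring_1) set \<Rightarrow> ('b \<Rightarrow>\<^sub>0 'r) set \<Rightarrow> (('a \<Rightarrow>\<^sub>0 'r) \<Rightarrow> ('b \<Rightarrow>\<^sub>0 'r)) \<Rightarrow> bool" where
  "linear_on M N f \<longleftrightarrow>
     (\<forall>x\<in>M. f x \<in> N) \<and>
     (\<forall>x\<in>M. \<forall>y\<in>M. f (x + y) = f x + f y) \<and>
     (\<forall>c. \<forall>x\<in>M. f (scale c x) = scale c (f x))"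

definition basis_ext :: "('a \<Rightarrow> 'b) \<Rightarrow> ('a \<Rightarrow>\<^sub>0 'r::comm_ring_1) \<Rightarrow> ('b \<Rightarrow>\<^sub>0 'r)" where
  "basis_ext h x =
     (\<Sum>a\<in>Poly_Mapping.keys x. Poly_Mapping.single (h a) (Poly_Mapping.lookup x a))"


section \<open>The ground ring, its quotient, and free resolutions\<close>

text \<open>
  \<open>'r\<close> is a polynomial ring over the field \<open>'k\<close> (embedded by \<open>\<kappa>\<close>) in the set of variables
  \<open>X \<subseteq> 'r\<close>: evaluation of formal polynomials at the elements of \<open>X\<close> is bijective. The set \<open>X\<close> may
  be empty, in which case \<open>'r\<close> is \<open>'k\<close>.
\<close>

definition poly_eval ::
  "('k::field \<Rightarrow> 'r::comm_ring_1) \<Rightarrow> (('r \<Rightarrow>\<^sub>0 nat) \<Rightarrow>\<^sub>0 'k) \<Rightarrow> 'r" where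
  "poly_eval \<kappa> p =
     (\<Sum>m\<in>Poly_Mapping.keys p. \<kappa> (Poly_Mapping.lookup p m) *
        (\<Prod>x\<in>Poly_Mapping.keys m. x ^ Poly_Mapping.lookup m x))"

definition polynomial_ring :: "('k::field \<Rightarrow> 'r::comm_ring_1) \<Rightarrow> 'r set \<Rightarrow> bool" where
  "polynomial_ring \<kappa> X \<longleftrightarrow>
     \<kappa> 1 = 1 \<and> (\<forall>a b. \<kappa> (a + b) = \<kappa> a + \<kappa> b) \<and> (\<forall>a b. \<kappa> (a * b) = \<kappa> a * \<kappa> b) \<and>
     bij_betw (poly_eval \<kappa>) {p. \<forall>m\<in>Poly_Mapping.keys p. Poly_Mapping.keys m \<subseteq> X} UNIV"

text \<open>
  The quotient \<open>S\<close> is the target of a surjective ring homomorphism. The class \<open>comm_ring\<close> does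
  not require \<open>0 \<noteq> 1\<close>, so that \<open>S = 0\<close> is allowed; the unit of \<open>S\<close> is the image of \<open>1\<close>.
\<close>

definition quotient_map :: "('r::comm_ring_1 \<Rightarrow> 's::comm_ring) \<Rightarrow> bool" where
  "quotient_map \<pi> \<longleftrightarrow>
     (\<forall>a b. \<pi> (a + b) = \<pi> a + \<pi> b) \<and> (\<forall>a b. \<pi> (a * b) = \<pi> a * \<pi> b) \<and> surj \<pi>"

text \<open>
  \<open>F\<^sub>j\<close> is free with basis \<open>B j\<close>, and \<open>d j\<close> maps \<open>F\<^sub>j\<close> to \<open>F\<^sub>j\<^sub>-\<^sub>1\<close> for \<open>j \<ge> 1\<close>. The basis
  \<open>{e0}\<close> of \<open>F\<^sub>0\<close> identifies \<open>F\<^sub>0\<close> with \<open>R\<close>.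
\<close>

definition free_resolution ::
  "(nat \<Rightarrow> 'b set) \<Rightarrow> 'b \<Rightarrow> (nat \<Rightarrow> ('b \<Rightarrow>\<^sub>0 'r) \<Rightarrow> ('b \<Rightarrow>\<^sub>0 'r)) \<Rightarrow>
     ('r::comm_ring_1 \<Rightarrow> 's::comm_ring) \<Rightarrow> bool" where
  "free_resolution B e0 d \<pi> \<longleftrightarrow>
     B 0 = {e0} \<and>
     (\<forall>j\<ge>1. linear_on (free_mod (B j)) (free_mod (B (j - 1))) (d j)) \<and>
     (\<forall>j\<ge>1. {x \<in> free_mod (B j). d j x = 0} = d (Suc j) ` free_mod (B (Suc j))) \<and>
     {x \<in> free_mod (B 0). \<pi> (Poly_Mapping.lookup x e0) = 0} = d 1 ` free_mod (B 1)"


section \<open>Graded symmetric algebras of graded free modules\<close>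

text \<open>
  For a set \<open>G\<close> of generators with degrees \<open>deg\<close>, the graded symmetric algebra over \<open>R\<close> of the
  graded free module with basis \<open>G\<close> is the free module on the monomials in \<open>G\<close> in which generators
  of odd degree occur at most once. A monomial is a multiset, which stands for the product of its
  generators in increasing order with respect to a strict linear order \<open>r\<close>. Multiplication of
  monomials therefore produces the Koszul sign of the permutation that sorts the concatenation.
\<close>

definition mdeg :: "('g \<Rightarrow> nat) \<Rightarrow> 'g multiset \<Rightarrow> nat" where
  "mdeg deg m = (\<Sum>g\<in>#m. deg g)"

definition gmons :: "('g \<Rightarrow> nat) \<Rightarrow> 'g set \<Rightarrow> nat \<Rightarrow> 'g multiset set" where
  "gmons deg G n =
     {m. set_mset m \<subseteq> G \<and> (\<forall>g\<in>G. odd (deg g) \<longrightarrow> count m g \<le> 1) \<and> mdeg deg m = n}"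

definition sym_part :: "('g \<Rightarrow> nat) \<Rightarrow> 'g set \<Rightarrow> nat \<Rightarrow> ('g multiset \<Rightarrow>\<^sub>0 'r::comm_ring_1) set" where
  "sym_part deg G n = free_mod (gmons deg G n)"

definition koszul_coeff ::
  "('g \<Rightarrow> nat) \<Rightarrow> 'g rel \<Rightarrow> 'g multiset \<Rightarrow> 'g multiset \<Rightarrow> 'r::comm_ring_1" where
  "koszul_coeff deg r m n =
     (if \<exists>g. g \<in># m \<and> g \<in># n \<and> odd (deg g) then 0
      else (- 1) ^ (\<Sum>a\<in>#m. \<Sum>b\<in>#n.
             if odd (deg a) \<and> odd (deg b) \<and> (b, a) \<in> r then 1 else 0))"

definition sym_mult ::
  "('g \<Rightarrow> nat) \<Rightarrow> 'g rel \<Rightarrow> ('g multiset \<Rightarrow>\<^sub>0 'r::comm_ring_1) \<Rightarrow> ('g multiset \<Rightarrow>\<^sub>0 'r) \<Rightarrow>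
     ('g multiset \<Rightarrow>\<^sub>0 'r)" where
  "sym_mult deg r x y =
     (\<Sum>m\<in>Poly_Mapping.keys x. \<Sum>n\<in>Poly_Mapping.keys y.
        Poly_Mapping.single (m + n)
          (koszul_coeff deg r m n * Poly_Mapping.lookup x m * Poly_Mapping.lookup y n))"

definition sym_scalar :: "'r::comm_ring_1 \<Rightarrow> ('g multiset \<Rightarrow>\<^sub>0 'r)" where
  "sym_scalar c = Poly_Mapping.single {#} c"


section \<open>Complexes, homology and Koszul-Tate resolutions\<close>

text \<open>
  A complex is a family of carriers \<open>A n\<close> with maps \<open>D n\<close> defined on \<open>A n\<close>; the
  module of degree \<open>-1\<close> is zero, so \<open>D 0\<close> must vanish on \<open>A 0\<close>.
\<close>

definition cycles :: "(nat \<Rightarrow> 'a set) \<Rightarrow> (nat \<Rightarrow> 'a \<Rightarrow> 'a::ab_group_add) \<Rightarrow> nat \<Rightarrow> 'a set" where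
  "cycles A D n = {x \<in> A n. D n x = 0}"

definition homologous ::
  "(nat \<Rightarrow> 'a set) \<Rightarrow> (nat \<Rightarrow> 'a \<Rightarrow> 'a::ab_group_add) \<Rightarrow> nat \<Rightarrow> 'a rel" where
  "homologous A D n =
     {(x, y). x \<in> cycles A D n \<and> y \<in> cycles A D n \<and> x - y \<in> D (Suc n) ` A (Suc n)}"

definition homology ::
  "(nat \<Rightarrow> 'a set) \<Rightarrow> (nat \<Rightarrow> 'a \<Rightarrow> 'a::ab_group_add) \<Rightarrow> nat \<Rightarrow> 'a set set" where
  "homology A D n = cycles A D n // homologous A D n"

definition homology_class ::
  "(nat \<Rightarrow> 'a set) \<Rightarrow> (nat \<Rightarrow> 'a \<Rightarrow> 'a::ab_group_add) \<Rightarrow> nat \<Rightarrow> 'a \<Rightarrow> 'a set" where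
  "homology_class A D n x = homologous A D n `` {x}"

definition quasi_iso ::
  "(nat \<Rightarrow> 'a set) \<Rightarrow> (nat \<Rightarrow> 'a \<Rightarrow> 'a::ab_group_add) \<Rightarrow>
   (nat \<Rightarrow> 'c set) \<Rightarrow> (nat \<Rightarrow> 'c \<Rightarrow> 'c::ab_group_add) \<Rightarrow> (nat \<Rightarrow> 'a \<Rightarrow> 'c) \<Rightarrow> bool" where
  "quasi_iso A D C E f \<longleftrightarrow>
     (\<forall>n. \<forall>x\<in>A n. f n x \<in> C n) \<and>
     (\<forall>n. \<forall>x\<in>A n. \<forall>y\<in>A n. f n (x + y) = f n x + f n y) \<and>
     (\<forall>n. \<forall>x\<in>A (Suc n). f n (D (Suc n) x) = E (Suc n) (f (Suc n) x)) \<and>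
     (\<forall>n. \<exists>\<phi>. bij_betw \<phi> (homology A D n) (homology C E n) \<and>
        (\<forall>x\<in>cycles A D n. \<phi> (homology_class A D n x) = homology_class C E n (f n x)))"

definition graded_comm_algebra ::
  "(nat \<Rightarrow> ('a \<Rightarrow>\<^sub>0 'r::comm_ring_1) set) \<Rightarrow>
   (('a \<Rightarrow>\<^sub>0 'r) \<Rightarrow> ('a \<Rightarrow>\<^sub>0 'r) \<Rightarrow> ('a \<Rightarrow>\<^sub>0 'r)) \<Rightarrow> ('a \<Rightarrow>\<^sub>0 'r) \<Rightarrow> bool" where
  "graded_comm_algebra A mul u \<longleftrightarrow>
     (\<forall>n. 0 \<in> A n \<and> (\<forall>x\<in>A n. \<forall>y\<in>A n. x + y \<in> A n) \<and> (\<forall>c. \<forall>x\<in>A n. scale c x \<in> A n)) \<and>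
     u \<in> A 0 \<and>
     (\<forall>m n. \<forall>x\<in>A m. \<forall>y\<in>A n. mul x y \<in> A (m + n)) \<and>
     (\<forall>m n. \<forall>x\<in>A m. linear_on (A n) (A (m + n)) (mul x)) \<and>
     (\<forall>n. \<forall>x\<in>A n. mul u x = x) \<and>
     (\<forall>l m n. \<forall>x\<in>A l. \<forall>y\<in>A m. \<forall>z\<in>A n. mul (mul x y) z = mul x (mul y z)) \<and>
     (\<forall>m n. \<forall>x\<in>A m. \<forall>y\<in>A n. mul y x = scale ((- 1) ^ (m * n)) (mul x y))"

definition leibniz_at ::
  "(nat \<Rightarrow> ('a \<Rightarrow>\<^sub>0 'r::comm_ring_1) set) \<Rightarrow>
   (('a \<Rightarrow>\<^sub>0 'r) \<Rightarrow> ('a \<Rightarrow>\<^sub>0 'r) \<Rightarrow> ('a \<Rightarrow>\<^sub>0 'r)) \<Rightarrow>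
   (nat \<Rightarrow> ('a \<Rightarrow>\<^sub>0 'r) \<Rightarrow> ('a \<Rightarrow>\<^sub>0 'r)) \<Rightarrow> nat \<Rightarrow> bool" where
  "leibniz_at A mul D j \<longleftrightarrow>
     (\<forall>k\<le>j. \<forall>y\<in>A k. \<forall>z\<in>A (j - k).
        D j (mul y z) = mul (D k y) z + scale ((- 1) ^ k) (mul y (D (j - k) z)))"

definition cdga ::
  "(nat \<Rightarrow> ('a \<Rightarrow>\<^sub>0 'r::comm_ring_1) set) \<Rightarrow>
   (('a \<Rightarrow>\<^sub>0 'r) \<Rightarrow> ('a \<Rightarrow>\<^sub>0 'r) \<Rightarrow> ('a \<Rightarrow>\<^sub>0 'r)) \<Rightarrow> ('a \<Rightarrow>\<^sub>0 'r) \<Rightarrow>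
   (nat \<Rightarrow> ('a \<Rightarrow>\<^sub>0 'r) \<Rightarrow> ('a \<Rightarrow>\<^sub>0 'r)) \<Rightarrow> bool" where
  "cdga A mul u D \<longleftrightarrow>
     graded_comm_algebra A mul u \<and>
     (\<forall>x\<in>A 0. D 0 x = 0) \<and>
     (\<forall>n. linear_on (A (Suc n)) (A n) (D (Suc n))) \<and>
     (\<forall>n. \<forall>x\<in>A (Suc n). D n (D (Suc n) x) = 0) \<and>
     (\<forall>n. leibniz_at A mul D n)"

text \<open>
  The ring \<open>S\<close> as a complex concentrated in degree \<open>0\<close>, and the augmentation that sends \<open>c \<in> R\<close>
  to its residue class and vanishes on all generators of positive degree.
\<close>

definition conc :: "nat \<Rightarrow> 's::comm_ring set" where
  "conc n = (if n = 0 then UNIV else {0})"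

definition augmentation ::
  "('r::comm_ring_1 \<Rightarrow> 's::comm_ring) \<Rightarrow> nat \<Rightarrow> ('g multiset \<Rightarrow>\<^sub>0 'r) \<Rightarrow> 's" where
  "augmentation \<pi> n x = (if n = 0 then \<pi> (Poly_Mapping.lookup x {#}) else 0)"

text \<open>
  Freeness: since \<open>R\<close> is the polynomial ring over \<open>'k\<close> on \<open>X\<close>, the graded symmetric algebra
  over \<open>R\<close> on a set \<open>G\<close> of generators of positive degree is the free graded commutative
  \<open>'k\<close>-algebra on \<open>X\<close> (in degree \<open>0\<close>) and \<open>G\<close>.
\<close>

definition koszul_tate_resolution ::
  "('k::field \<Rightarrow> 'r::comm_ring_1) \<Rightarrow> 'r set \<Rightarrow> ('r \<Rightarrow> 's::comm_ring) \<Rightarrow> ('g \<Rightarrow> nat) \<Rightarrow> 'g rel \<Rightarrow>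
   (nat \<Rightarrow> ('g multiset \<Rightarrow>\<^sub>0 'r) set) \<Rightarrow>
   (nat \<Rightarrow> ('g multiset \<Rightarrow>\<^sub>0 'r) \<Rightarrow> ('g multiset \<Rightarrow>\<^sub>0 'r)) \<Rightarrow> bool" where
  "koszul_tate_resolution \<kappa> X \<pi> deg r A D \<longleftrightarrow>
     cdga A (sym_mult deg r) (sym_scalar 1) D \<and>
     polynomial_ring \<kappa> X \<and>
     (\<exists>G. (\<forall>g\<in>G. 0 < deg g) \<and> (\<forall>n. A n = sym_part deg G n)) \<and>
     (\<forall>x\<in>A 0. \<forall>y\<in>A 0.
        augmentation \<pi> 0 (sym_mult deg r x y) = augmentation \<pi> 0 x * augmentation \<pi> 0 y) \<and>
     (\<forall>c. augmentation \<pi> 0 (sym_scalar c :: 'g multiset \<Rightarrow>\<^sub>0 'r) = \<pi> c) \<and>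
     quasi_iso A D conc (\<lambda>_ _. 0) (augmentation \<pi>)"


section \<open>The algebra constructed from a free resolution\<close>

text \<open>
  \<open>Base j e\<close> is the generator given by the basis element \<open>e\<close> of \<open>F\<^sub>j\<close>; \<open>Susp m\<close> is the generator
  of degree \<open>j\<close> given by the basis monomial \<open>m\<close> of \<open>P\<^sub>j\<^sub>-\<^sub>1\<^sup>o\<^sup>l\<^sup>d\<close>, viewed in \<open>P\<^sub>j\<^sup>n\<^sup>e\<^sup>w\<close>.
\<close>

datatype 'b gen = Base nat 'b | Susp "'b gen multiset"

primrec gdeg :: "'b gen \<Rightarrow> nat" where
  "gdeg (Base j e) = j"
| "gdeg (Susp m) = Suc (sum_mset (image_mset gdeg m))"

text \<open>\<open>gens B i\<close> is the basis of the sum of the \<open>P\<^sub>j\<^sup>n\<^sup>e\<^sup>w\<close> with \<open>1 \<le> j \<le> i\<close>.\<close>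

fun gens :: "(nat \<Rightarrow> 'b set) \<Rightarrow> nat \<Rightarrow> 'b gen set" where
  "gens B 0 = {}"
| "gens B (Suc 0) = Base 1 ` B 1"
| "gens B (Suc (Suc i)) =
     gens B (Suc i) \<union> Base (Suc (Suc i)) ` B (Suc (Suc i)) \<union> Susp ` gmons gdeg (gens B i) (Suc i)"

type_synonym ('b, 'r) alg = "'b gen multiset \<Rightarrow>\<^sub>0 'r"

definition P_stage :: "(nat \<Rightarrow> 'b set) \<Rightarrow> nat \<Rightarrow> nat \<Rightarrow> ('b, 'r::comm_ring_1) alg set" where
  "P_stage B i n = sym_part gdeg (gens B i) n"

definition P_part :: "(nat \<Rightarrow> 'b set) \<Rightarrow> nat \<Rightarrow> ('b, 'r::comm_ring_1) alg set" where
  "P_part B n = (\<Union>i. P_stage B i n)"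

definition P_old :: "(nat \<Rightarrow> 'b set) \<Rightarrow> nat \<Rightarrow> ('b, 'r::comm_ring_1) alg set" where
  "P_old B j = (case j of 0 \<Rightarrow> {0} | Suc i \<Rightarrow> P_stage B i (Suc i))"

definition incl_F :: "nat \<Rightarrow> ('b \<Rightarrow>\<^sub>0 'r::comm_ring_1) \<Rightarrow> ('b, 'r) alg" where
  "incl_F j = basis_ext (\<lambda>e. if j = 0 then {#} else {#Base j e#})"

definition susp :: "('b, 'r::comm_ring_1) alg \<Rightarrow> ('b, 'r) alg" where
  "susp = basis_ext (\<lambda>m. {#Susp m#})"

text \<open>
  Form (A), for \<open>j \<ge> 1\<close>: the argument \<open>(f, u, v)\<close> in \<open>F\<^sub>j \<oplus> P\<^sub>j\<^sub>-\<^sub>1\<^sup>o\<^sup>l\<^sup>d \<oplus> P\<^sub>j\<^sup>o\<^sup>l\<^sup>d\<close> is the element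
  \<open>incl_F j f + susp u + v\<close> of \<open>P\<^sub>j\<close>, and \<open>\<gamma>'\<close> is the map \<open>\<gamma>\<^sub>j\<^sub>-\<^sub>1\<close>. For \<open>j = 1\<close> the index \<open>j - 2\<close>
  is truncated to \<open>0\<close>; this is correct because \<open>P_old B 0\<close> and the old part in degree \<open>-1\<close> are
  both zero.
\<close>

definition form_A ::
  "(nat \<Rightarrow> 'b set) \<Rightarrow> (nat \<Rightarrow> ('b \<Rightarrow>\<^sub>0 'r) \<Rightarrow> ('b \<Rightarrow>\<^sub>0 'r)) \<Rightarrow> nat \<Rightarrow>
   (('b, 'r::comm_ring_1) alg \<Rightarrow> ('b, 'r) alg) \<Rightarrow>
   (('b, 'r) alg \<Rightarrow> ('b \<Rightarrow>\<^sub>0 'r)) \<Rightarrow> (('b, 'r) alg \<Rightarrow> ('b \<Rightarrow>\<^sub>0 'r)) \<Rightarrow>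
   (('b, 'r) alg \<Rightarrow> ('b, 'r) alg) \<Rightarrow> (('b, 'r) alg \<Rightarrow> ('b, 'r) alg) \<Rightarrow>
   (('b, 'r) alg \<Rightarrow> ('b, 'r) alg) \<Rightarrow> bool" where
  "form_A B d j D \<rho> \<alpha> \<beta> \<gamma>' \<gamma> \<longleftrightarrow>
     linear_on (P_part B j) (P_part B (j - 1)) D \<and>
     linear_on (P_old B (j - 1)) (free_mod (B (j - 1))) \<rho> \<and>
     linear_on (P_old B j) (free_mod (B (j - 1))) \<alpha> \<and>
     linear_on (P_old B j) (P_old B (j - 2)) \<beta> \<and>
     linear_on (P_old B j) (P_old B (j - 1)) \<gamma> \<and>
     (\<forall>f\<in>free_mod (B j). \<forall>u\<in>P_old B (j - 1). \<forall>v\<in>P_old B j.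
        D (incl_F j f + susp u + v) =
          incl_F (j - 1) (d j f - \<rho> u + \<alpha> v) + susp (- \<gamma>' u + \<beta> v) + (u + \<gamma> v))"

definition square_zero_at ::
  "(nat \<Rightarrow> 'b set) \<Rightarrow> (nat \<Rightarrow> ('b, 'r::comm_ring_1) alg \<Rightarrow> ('b, 'r) alg) \<Rightarrow> nat \<Rightarrow> bool" where
  "square_zero_at B D j \<longleftrightarrow> (\<forall>x\<in>P_part B j. D (j - 1) (D j x) = 0)"

text \<open>Maps \<open>\<partial>\<^sub>j\<close> for \<open>j \<le> i\<close> as in the induction hypothesis, with their matrix entries.\<close>

definition differential_upto ::
  "(nat \<Rightarrow> 'b set) \<Rightarrow> (nat \<Rightarrow> ('b \<Rightarrow>\<^sub>0 'r) \<Rightarrow> ('b \<Rightarrow>\<^sub>0 'r)) \<Rightarrow> 'b gen rel \<Rightarrow> nat \<Rightarrow>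
   (nat \<Rightarrow> ('b, 'r::comm_ring_1) alg \<Rightarrow> ('b, 'r) alg) \<Rightarrow>
   (nat \<Rightarrow> ('b, 'r) alg \<Rightarrow> ('b \<Rightarrow>\<^sub>0 'r)) \<Rightarrow> (nat \<Rightarrow> ('b, 'r) alg \<Rightarrow> ('b \<Rightarrow>\<^sub>0 'r)) \<Rightarrow>
   (nat \<Rightarrow> ('b, 'r) alg \<Rightarrow> ('b, 'r) alg) \<Rightarrow> (nat \<Rightarrow> ('b, 'r) alg \<Rightarrow> ('b, 'r) alg) \<Rightarrow> bool" where
  "differential_upto B d r i D \<rho> \<alpha> \<beta> \<gamma> \<longleftrightarrow>
     (\<forall>x\<in>P_part B 0. D 0 x = 0) \<and>
     (\<forall>f\<in>free_mod (B 1). D 1 (incl_F 1 f) = incl_F 0 (d 1 f)) \<and>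
     (\<forall>u\<in>P_old B 0. \<gamma> 0 u = 0) \<and>
     (\<forall>j\<in>{1..i}.
        form_A B d j (D j) (\<rho> j) (\<alpha> j) (\<beta> j) (\<gamma> (j - 1)) (\<gamma> j) \<and>
        leibniz_at (P_part B) (sym_mult gdeg r) D j \<and>
        square_zero_at B D j)"

text \<open>The condition on \<open>\<rho>\<^sub>i\<^sub>+\<^sub>1\<close>, as a map \<open>\<rho>'\<close> from \<open>P\<^sub>i\<^sup>o\<^sup>l\<^sup>d\<close> to \<open>F\<^sub>i\<close>.\<close>

definition rho_lift ::
  "(nat \<Rightarrow> 'b set) \<Rightarrow> (nat \<Rightarrow> ('b \<Rightarrow>\<^sub>0 'r) \<Rightarrow> ('b \<Rightarrow>\<^sub>0 'r)) \<Rightarrow> nat \<Rightarrow>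
   (nat \<Rightarrow> ('b, 'r::comm_ring_1) alg \<Rightarrow> ('b \<Rightarrow>\<^sub>0 'r)) \<Rightarrow>
   (nat \<Rightarrow> ('b, 'r) alg \<Rightarrow> ('b \<Rightarrow>\<^sub>0 'r)) \<Rightarrow> (nat \<Rightarrow> ('b, 'r) alg \<Rightarrow> ('b, 'r) alg) \<Rightarrow>
   (('b, 'r) alg \<Rightarrow> ('b \<Rightarrow>\<^sub>0 'r)) \<Rightarrow> bool" where
  "rho_lift B d i \<rho> \<alpha> \<gamma> \<rho>' \<longleftrightarrow>
     linear_on (P_old B i) (free_mod (B i)) \<rho>' \<and>
     (\<forall>u\<in>P_old B i. d i (\<rho>' u) = \<rho> i (\<gamma> i u) + \<alpha> i u)"

text \<open>
  \<open>D'\<close> is an admissible \<open>\<partial>\<^sub>i\<^sub>+\<^sub>1\<close> for the given \<open>\<partial>\<^sub>j\<close>, \<open>j \<le> i\<close>, and the choice \<open>\<rho>'\<close> of \<open>\<rho>\<^sub>i\<^sub>+\<^sub>1\<close>.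
\<close>

definition next_differential ::
  "(nat \<Rightarrow> 'b set) \<Rightarrow> (nat \<Rightarrow> ('b \<Rightarrow>\<^sub>0 'r) \<Rightarrow> ('b \<Rightarrow>\<^sub>0 'r)) \<Rightarrow> 'b gen rel \<Rightarrow> nat \<Rightarrow>
   (nat \<Rightarrow> ('b, 'r::comm_ring_1) alg \<Rightarrow> ('b, 'r) alg) \<Rightarrow>
   (nat \<Rightarrow> ('b, 'r) alg \<Rightarrow> ('b, 'r) alg) \<Rightarrow>
   (('b, 'r) alg \<Rightarrow> ('b \<Rightarrow>\<^sub>0 'r)) \<Rightarrow> (('b, 'r) alg \<Rightarrow> ('b, 'r) alg) \<Rightarrow> bool" where
  "next_differential B d r i D \<gamma> \<rho>' D' \<longleftrightarrow>
     (\<exists>\<alpha>' \<beta>' \<gamma>'. form_A B d (Suc i) D' \<rho>' \<alpha>' \<beta>' (\<gamma> i) \<gamma>') \<and>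
     leibniz_at (P_part B) (sym_mult gdeg r) (D(Suc i := D')) (Suc i) \<and>
     square_zero_at B (D(Suc i := D')) (Suc i)"

definition inductive_differential ::
  "(nat \<Rightarrow> 'b set) \<Rightarrow> (nat \<Rightarrow> ('b \<Rightarrow>\<^sub>0 'r) \<Rightarrow> ('b \<Rightarrow>\<^sub>0 'r)) \<Rightarrow> 'b gen rel \<Rightarrow>
   (nat \<Rightarrow> ('b, 'r::comm_ring_1) alg \<Rightarrow> ('b, 'r) alg) \<Rightarrow> bool" where
  "inductive_differential B d r D \<longleftrightarrow>
     (\<exists>\<rho> \<alpha> \<beta> \<gamma>. \<forall>i\<ge>1. differential_upto B d r i D \<rho> \<alpha> \<beta> \<gamma> \<and>
        rho_lift B d i \<rho> \<alpha> \<gamma> (\<rho> (Suc i)))"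

end

theory Submission
  imports Defs
begin

text \<open>
  A family of maps satisfying the Leibniz rule is determined by its values on the generators, and
  conversely arbitrary values on the generators extend to the derivation
  \<open>m \<mapsto> \<Sum>g\<in>m. \<plusminus> \<partial>g \<sqdot> (m - g)\<close>, the sign being the one that moves \<open>g\<close> to the front of the
  monomial \<open>m\<close>. Form (A) prescribes \<open>\<partial>\<^sub>i\<^sub>+\<^sub>1\<close> on the generators of degree \<open>i + 1\<close>, namely on
  \<open>F\<^sub>i\<^sub>+\<^sub>1\<close> and on the suspension of \<open>P\<^sub>i\<^sup>o\<^sup>l\<^sup>d\<close>; since the square of a derivation of odd degree is a
  derivation, \<open>\<partial>\<^sup>2 = 0\<close> only has to be checked on generators, where it amounts to the equation
  for \<open>\<rho>\<^sub>i\<^sub>+\<^sub>1\<close>. That equation is solvable because \<open>\<partial>\<^sub>i\<^sub>-\<^sub>1\<partial>\<^sub>i = 0\<close> puts its right-hand side into the kernel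
  of \<open>d\<^sub>i\<^sub>-\<^sub>1\<close> and \<open>P\<^sub>i\<^sup>o\<^sup>l\<^sup>d\<close> is free.
  For the homology, the identity block in (A) shows that a cycle \<open>(f, u, v)\<close> has \<open>u = - \<gamma> v\<close>, so
  that subtracting the boundary of the suspension of \<open>v\<close> leaves a cycle \<open>(f + \<rho> v, 0, 0)\<close> of the
  exact complex \<open>F\<close>.
\<close>

section \<open>Free modules\<close>

text \<open>The empty multiset is the neutral element \<open>0\<close>, so \<open>single_one\<close> would rewrite the monomial
  \<open>single {#} 1\<close> to the unit of an unrelated ring structure.\<close>

declare Poly_Mapping.single_one [simp del]

abbreviation lookup where "lookup \<equiv> Poly_Mapping.lookup"
abbreviation keys where "keys \<equiv> Poly_Mapping.keys"
abbreviation single where "single \<equiv> Poly_Mapping.single"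

lemma lookup_scale [simp]: "lookup (scale c x) k = c * lookup x k"
  unfolding scale_def by (transfer) (auto simp: when_def)

lemma scale_add_right: "scale c (x + y) = scale c x + scale c y"
  by (rule poly_mapping_eqI) (simp add: lookup_add algebra_simps)

lemma scale_add_left: "scale (a + b) x = scale a x + scale b x"
  by (rule poly_mapping_eqI) (simp add: lookup_add algebra_simps)

lemma scale_scale [simp]: "scale a (scale b x) = scale (a * b) x"
  by (rule poly_mapping_eqI) (simp add: algebra_simps)

lemma scale_one [simp]: "scale 1 x = x"
  by (rule poly_mapping_eqI) simp

lemma scale_zero_left [simp]: "scale 0 x = 0"
  by (rule poly_mapping_eqI) simp

lemma scale_zero_right [simp]: "scale c 0 = 0"
  by (rule poly_mapping_eqI) simp

lemma scale_minus_right [simp]: "scale c (- x) = - scale c x"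
  by (rule poly_mapping_eqI) (simp add: lookup_uminus)

lemma scale_minus_left [simp]: "scale (- c) x = - scale c x"
  by (rule poly_mapping_eqI) (simp add: lookup_uminus)

lemma scale_single [simp]: "scale c (single k v) = single k (c * v)"
  by (rule poly_mapping_eqI) (simp add: lookup_single when_def)

lemma scale_sum: "scale c (sum f S) = (\<Sum>s\<in>S. scale c (f s))"
  by (induction S rule: infinite_finite_induct) (auto simp: scale_add_right)

lemma scale_sum_mset: "scale c (\<Sum>s\<in>#M. f s) = (\<Sum>s\<in>#M. scale c (f s))"
  by (induction M) (auto simp: scale_add_right)

lemma free_mod_iff: "x \<in> free_mod B \<longleftrightarrow> (\<forall>b. b \<notin> B \<longrightarrow> lookup x b = 0)"
  unfolding free_mod_def by (auto simp: in_keys_iff)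

lemma free_mod_zero [simp, intro]: "0 \<in> free_mod B"
  by (simp add: free_mod_iff)

lemma free_mod_add [intro]: "x \<in> free_mod B \<Longrightarrow> y \<in> free_mod B \<Longrightarrow> x + y \<in> free_mod B"
  by (auto simp: free_mod_iff lookup_add)

lemma free_mod_scale [intro]: "x \<in> free_mod B \<Longrightarrow> scale c x \<in> free_mod B"
  by (auto simp: free_mod_iff)

lemma free_mod_uminus [intro]: "x \<in> free_mod B \<Longrightarrow> - x \<in> free_mod B"
  by (auto simp: free_mod_iff lookup_uminus)

lemma free_mod_diff [intro]: "x \<in> free_mod B \<Longrightarrow> y \<in> free_mod B \<Longrightarrow> x - y \<in> free_mod B"
  by (auto simp: free_mod_iff lookup_minus)

lemma free_mod_sum: "(\<And>s. s \<in> S \<Longrightarrow> f s \<in> free_mod B) \<Longrightarrow> sum f S \<in> free_mod B"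
  by (induction S rule: infinite_finite_induct) auto

lemma free_mod_single [intro]: "b \<in> B \<Longrightarrow> single b c \<in> free_mod B"
  by (auto simp: free_mod_iff lookup_single when_def)

lemma free_mod_mono: "B \<subseteq> C \<Longrightarrow> free_mod B \<subseteq> free_mod C"
  by (auto simp: free_mod_def)

lemma free_mod_empty [simp]: "free_mod {} = {0}"
  by (auto simp: free_mod_def)

lemma poly_mapping_sum_single: "x = (\<Sum>a\<in>keys x. single a (lookup x a))"
  by (rule poly_mapping_eqI) (auto simp: lookup_sum lookup_single when_def in_keys_iff)

text \<open>The sum over the support is built up one basis element at a time. Every partial sum
  stays in the module, so the \<open>add\<close> case may assume membership, as maps that are linear
  only on a carrier require.\<close>

lemma free_mod_induct [consumes 1, case_names zero single add]:
  assumes x: "x \<in> free_mod B"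
    and "P 0"
    and "\<And>b c. b \<in> B \<Longrightarrow> P (single b c)"
    and "\<And>x y. x \<in> free_mod B \<Longrightarrow> y \<in> free_mod B \<Longrightarrow> P x \<Longrightarrow> P y \<Longrightarrow> P (x + y)"
  shows "P x"
proof -
  have "P (\<Sum>a\<in>S. single a (lookup x a)) \<and> (\<Sum>a\<in>S. single a (lookup x a)) \<in> free_mod B"
    if "finite S" "S \<subseteq> keys x" for S
    using that
  proof (induction S)
    case (insert a S)
    then have "a \<in> B" using x by (auto simp: free_mod_def)
    with insert show ?case by (auto intro!: assms)
  qed (auto simp: assms)
  from this[of "keys x"] show ?thesis
    by (simp flip: poly_mapping_sum_single)
qed

section \<open>Linear maps determined by their values on a basis\<close>

definition lin_ext :: "('a \<Rightarrow> ('b \<Rightarrow>\<^sub>0 'r)) \<Rightarrow> ('a \<Rightarrow>\<^sub>0 'r::comm_ring_1) \<Rightarrow> ('b \<Rightarrow>\<^sub>0 'r)" where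
  "lin_ext h x = (\<Sum>a\<in>keys x. scale (lookup x a) (h a))"

text \<open>Cancellation can make the support of a sum smaller than the union of the supports.
  Summing over a common finite superset lets additivity be proved term by term.\<close>

lemma lin_ext_superset:
  "finite S \<Longrightarrow> keys x \<subseteq> S \<Longrightarrow> lin_ext h x = (\<Sum>a\<in>S. scale (lookup x a) (h a))"
  unfolding lin_ext_def by (rule sum.mono_neutral_left) (auto simp: in_keys_iff)

lemma lin_ext_add: "lin_ext h (x + y) = lin_ext h x + lin_ext h y"
proof -
  let ?S = "keys x \<union> keys y"
  have "lin_ext h z = (\<Sum>a\<in>?S. scale (lookup z a) (h a))" if "z \<in> {x, y, x + y}" for z
    using that by (intro lin_ext_superset) (auto simp: in_keys_iff lookup_add)
  then show ?thesis
    by (simp add: lookup_add scale_add_left sum.distrib)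
qed

lemma lin_ext_scale: "lin_ext h (scale c x) = scale c (lin_ext h x)"
proof -
  have "lin_ext h (scale c x) = (\<Sum>a\<in>keys x. scale (lookup (scale c x) a) (h a))"
    by (intro lin_ext_superset) (auto simp: in_keys_iff)
  then show ?thesis
    by (simp add: lin_ext_def scale_sum)
qed

lemma lin_ext_zero [simp]: "lin_ext h 0 = 0"
  by (simp add: lin_ext_def)

lemma lin_ext_single [simp]: "lin_ext h (single a c) = scale c (h a)"
  by (simp add: lin_ext_superset[of "{a}"])

lemma lin_ext_uminus: "lin_ext h (- x) = - lin_ext h x"
  using lin_ext_scale[of h "- 1" x] by simp

lemma lin_ext_diff: "lin_ext h (x - y) = lin_ext h x - lin_ext h y"
  using lin_ext_add[of h x "- y"] by (simp add: lin_ext_uminus)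

lemma linear_on_lin_ext:
  assumes "\<And>b. b \<in> B \<Longrightarrow> h b \<in> free_mod C"
  shows "linear_on (free_mod B) (free_mod C) (lin_ext h)"
proof -
  have "lin_ext h x \<in> free_mod C" if "x \<in> free_mod B" for x
    unfolding lin_ext_def
    using assms that by (intro free_mod_sum free_mod_scale) (auto simp: free_mod_def)
  then show ?thesis
    by (simp add: linear_on_def lin_ext_add lin_ext_scale)
qed

lemma basis_ext_eq_lin_ext: "basis_ext h = lin_ext (\<lambda>a. single (h a) 1)"
  by (auto simp: basis_ext_def lin_ext_def fun_eq_iff)

lemma linear_onD:
  assumes "linear_on M N f" "x \<in> M"
  shows linear_on_in: "f x \<in> N" and linear_on_scale: "f (scale c x) = scale c (f x)"
  using assms by (auto simp: linear_on_def)

lemma linear_on_add: "linear_on M N f \<Longrightarrow> x \<in> M \<Longrightarrow> y \<in> M \<Longrightarrow> f (x + y) = f x + f y"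
  by (auto simp: linear_on_def)

lemma linear_on_zero: "linear_on (free_mod B) N f \<Longrightarrow> f 0 = 0"
  using linear_on_scale[of "free_mod B" N f 0 0] by simp

lemma linear_on_uminus: "linear_on M N f \<Longrightarrow> x \<in> M \<Longrightarrow> f (- x) = - f x"
  using linear_on_scale[of M N f x "- 1"] by simp

lemma linear_on_diff:
  "linear_on (free_mod B) N f \<Longrightarrow> x \<in> free_mod B \<Longrightarrow> y \<in> free_mod B \<Longrightarrow> f (x - y) = f x - f y"
  using linear_on_add[of "free_mod B" N f x "- y"] by (auto simp: linear_on_uminus free_mod_uminus)

lemma linear_on_comp:
  "linear_on M N f \<Longrightarrow> linear_on N K g \<Longrightarrow> linear_on M K (\<lambda>x. g (f x))"
  by (auto simp: linear_on_def)

lemma linear_on_subset: "linear_on M N f \<Longrightarrow> M' \<subseteq> M \<Longrightarrow> linear_on M' N f"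
  unfolding linear_on_def by blast

lemma linear_on_neg:
  "linear_on M (free_mod C) f \<Longrightarrow> linear_on M (free_mod C) (\<lambda>x. - f x)"
  by (auto simp: linear_on_def)

lemma linear_on_eqI:
  assumes "linear_on (free_mod B) N f" "linear_on (free_mod B) N' g"
    and "\<And>b. b \<in> B \<Longrightarrow> f (single b 1) = g (single b 1)"
    and "x \<in> free_mod B"
  shows "f x = g x"
  using assms(4)
proof (induction rule: free_mod_induct)
  case zero
  then show ?case using assms(1,2) by (simp add: linear_on_zero)
next
  case (single b c)
  then have "single b 1 \<in> free_mod B" by auto
  from linear_on_scale[OF assms(1) this, of c] linear_on_scale[OF assms(2) this, of c]
  show ?case using assms(3)[OF single] by simp
next
  case (add x y)
  then show ?case using assms(1,2) by (simp add: linear_on_add)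
qed


section \<open>Graded symmetric algebras\<close>

lemma mdeg_simps [simp]:
  "mdeg deg {#} = 0" "mdeg deg (add_mset g m) = deg g + mdeg deg m"
  "mdeg deg (m + n) = mdeg deg m + mdeg deg n"
  by (auto simp: mdeg_def)

lemma koszul_coeff_empty [simp]: "koszul_coeff deg r {#} m = 1" "koszul_coeff deg r m {#} = 1"
  by (auto simp: koszul_coeff_def)

text \<open>Inversions are counted pairwise, so both exponents are the total over the pairs
  \<open>(m, n)\<close>, \<open>(m, p)\<close> and \<open>(n, p)\<close>, and both sides vanish as
  soon as one of these pairs shares an odd generator. This is associativity of the product on
  monomials.\<close>

lemma koszul_cocycle:
  "(koszul_coeff deg r m n * koszul_coeff deg r (m + n) p :: 'r::comm_ring_1) =
     koszul_coeff deg r n p * koszul_coeff deg r m (n + p)"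
  by (auto simp: koszul_coeff_def power_add sum_mset.distrib)

lemma koszul_coeff_square:
  assumes "\<not> (\<exists>g. g \<in># m \<and> g \<in># n \<and> odd (deg g))"
  shows "koszul_coeff deg r m n * koszul_coeff deg r m n = (1 :: 'r::comm_ring_1)"
  using assms by (auto simp: koszul_coeff_def simp flip: power_add)

lemma koszul_coeff_odd:
  "g \<in># m \<Longrightarrow> g \<in># n \<Longrightarrow> odd (deg g) \<Longrightarrow> koszul_coeff deg r m n = 0"
  by (auto simp: koszul_coeff_def)

lemma minus_one_power_cong:
  "even a = even b \<Longrightarrow> (- 1 :: 'r::comm_ring_1) ^ a = (- 1) ^ b"
  by (cases "even a") auto

lemma even_mdeg: "even (mdeg deg m) = even (size (filter_mset (\<lambda>a. odd (deg a)) m))"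
  by (induction m) auto

text \<open>If no odd generator is shared, each pair of odd generators is inverted in exactly one of
  the two orders, because \<open>r\<close> is total and asymmetric. The two exponents therefore add
  up to the product of the numbers of odd generators, which has the parity of the product of the
  degrees.\<close>

lemma koszul_coeff_swap:
  assumes "strict_linear_order r"
  shows "koszul_coeff deg r n m =
    ((- 1) ^ (mdeg deg m * mdeg deg n) * koszul_coeff deg r m n :: 'r::comm_ring_1)"
proof (cases "\<exists>g. g \<in># m \<and> g \<in># n \<and> odd (deg g)")
  case True
  then show ?thesis by (auto simp: koszul_coeff_def)
next
  case disj: False
  have r: "total r" "\<And>a b. (a, b) \<in> r \<Longrightarrow> (b, a) \<notin> r"
    using assms unfolding strict_linear_order_on_def by (auto dest: irreflD transD)
  define e where "e m n = (\<Sum>a\<in>#m. \<Sum>b\<in>#n.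
    if odd (deg a) \<and> odd (deg b) \<and> (b, a) \<in> r then 1 else 0 :: nat)" for m n
  \<comment> \<open>These are the pairs already in increasing order; they become the inversions once
    \<open>m\<close> and \<open>n\<close> are exchanged.\<close>
  define e' where "e' m n = (\<Sum>a\<in>#m. \<Sum>b\<in>#n.
    if odd (deg a) \<and> odd (deg b) \<and> (a, b) \<in> r then 1 else 0 :: nat)" for m n
  define s where "s m = size (filter_mset (\<lambda>a. odd (deg a)) m)" for m
  have swap: "e n m = e' m n"
    unfolding e_def e'_def by (subst sum_mset.swap) (simp add: conj_ac)
  have "e m n + e' m n = (\<Sum>a\<in>#m. \<Sum>b\<in>#n. if odd (deg a) \<and> odd (deg b) then 1 else 0)"
    unfolding e_def e'_def sum_mset.distrib [symmetric]
  proof (intro arg_cong[where f = sum_mset] image_mset_cong)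
    fix a b assume "a \<in># m" "b \<in># n"
    with disj have "odd (deg a) \<Longrightarrow> a \<noteq> b" by auto
    with r show "(if odd (deg a) \<and> odd (deg b) \<and> (b, a) \<in> r then 1 else 0) +
      (if odd (deg a) \<and> odd (deg b) \<and> (a, b) \<in> r then 1 else 0) =
      (if odd (deg a) \<and> odd (deg b) then 1 else (0::nat))"
      by (auto simp: total_on_def)
  qed
  also have "\<dots> = (\<Sum>a\<in>#m. if odd (deg a) then s n else 0)"
    unfolding s_def by (intro arg_cong[where f = sum_mset] image_mset_cong, induction n) auto
  also have "\<dots> = s m * s n"
    unfolding s_def by (induction m) auto
  finally have "e m n + e n m = s m * s n" by (simp add: swap)
  then have "even (e n m) = even (mdeg deg m * mdeg deg n + e m n)"
    using even_mdeg[of deg m] even_mdeg[of deg n] unfolding s_def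
    by (metis even_add even_mult_iff)
  then have "(- 1 :: 'r) ^ e n m = (- 1) ^ (mdeg deg m * mdeg deg n + e m n)"
    by (rule minus_one_power_cong)
  then show ?thesis
    using disj by (auto simp: koszul_coeff_def e_def power_add)
qed

section \<open>The product, its algebra laws, and induction on products of generators\<close>

abbreviation mon :: "'g multiset \<Rightarrow> ('g multiset \<Rightarrow>\<^sub>0 'r::comm_ring_1)" where
  "mon m \<equiv> single m 1"

locale graded_sym =
  fixes deg :: "'g \<Rightarrow> nat" and r :: "'g rel"
  assumes order: "strict_linear_order r"
begin

abbreviation \<kappa> where "\<kappa> \<equiv> koszul_coeff deg r"
abbreviation mul (infixl "\<star>" 70) where "x \<star> y \<equiv> sym_mult deg r x y"

lemma mul_eq_lin_ext: "x \<star> y = lin_ext (\<lambda>m. lin_ext (\<lambda>n. single (m + n) (\<kappa> m n)) y) x"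
  unfolding sym_mult_def lin_ext_def by (simp add: scale_sum mult_ac)

lemma mul_add_left: "(x + y) \<star> z = x \<star> z + y \<star> z"
  by (simp add: mul_eq_lin_ext lin_ext_add)

lemma mul_add_right: "z \<star> (x + y) = z \<star> x + z \<star> y"
  unfolding mul_eq_lin_ext lin_ext_add by (simp add: lin_ext_def scale_add_right sum.distrib)

lemma mul_scale_left [simp]: "scale c x \<star> y = scale c (x \<star> y)"
  by (simp add: mul_eq_lin_ext lin_ext_scale)

lemma mul_scale_right [simp]: "x \<star> scale c y = scale c (x \<star> y)"
  unfolding mul_eq_lin_ext lin_ext_scale by (simp add: lin_ext_def scale_sum mult_ac)

lemma mul_zero [simp]: "0 \<star> x = 0" "x \<star> 0 = 0"
  by (simp_all add: mul_eq_lin_ext) (simp add: lin_ext_def)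

lemma mul_sum_mset: "x \<star> (\<Sum>g\<in>#M. f g) = (\<Sum>g\<in>#M. x \<star> f g)"
  by (induction M) (auto simp: mul_add_right)

lemma mul_single: "single m a \<star> single n b = single (m + n) (\<kappa> m n * a * b)"
  by (simp add: mul_eq_lin_ext mult_ac)

lemma mon_mul: "mon m \<star> mon n = scale (\<kappa> m n) (mon (m + n))"
  by (simp add: mul_single)

lemma mon_one_left [simp]: "mon {#} \<star> x = x"
  by (simp add: mul_eq_lin_ext flip: basis_ext_eq_lin_ext)
     (simp add: basis_ext_def flip: poly_mapping_sum_single)

lemma in_free_mod_UNIV: "x \<in> free_mod UNIV"
  by (simp add: free_mod_def)

text \<open>By trilinearity only products of three monomials matter, and there the claim is
  \<open>koszul_cocycle\<close>.\<close>

lemma mul_assoc: "(x \<star> y) \<star> z = x \<star> (y \<star> z)"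
proof -
  have 1: "(single a p \<star> single b q) \<star> z = single a p \<star> (single b q \<star> z)" for a b p q
    using in_free_mod_UNIV[of z]
  proof (induction rule: free_mod_induct)
    case (single c s)
    have "(\<kappa> (a + b) c * (\<kappa> a b * p * q) * s) = (\<kappa> a b * \<kappa> (a + b) c) * p * q * s"
      by (simp add: mult_ac)
    also have "\<dots> = \<kappa> a (b + c) * p * (\<kappa> b c * q * s)"
      by (simp add: koszul_cocycle mult_ac)
    finally show ?case by (simp add: mul_single add.assoc)
  qed (auto simp: mul_add_right)
  have 2: "(single a p \<star> y) \<star> z = single a p \<star> (y \<star> z)" for a p
    using in_free_mod_UNIV[of y]
    by (induction rule: free_mod_induct) (auto simp: mul_add_right mul_add_left 1)
  show ?thesis
    using in_free_mod_UNIV[of x]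
    by (induction rule: free_mod_induct) (auto simp: mul_add_left 2)
qed

lemma in_gmons_mdeg: "m \<in> gmons deg G n \<Longrightarrow> mdeg deg m = n"
  by (simp add: gmons_def)

lemma mul_commute:
  fixes x y :: "'g multiset \<Rightarrow>\<^sub>0 'r::comm_ring_1"
  assumes "x \<in> sym_part deg G m" "y \<in> sym_part deg G n"
  shows "y \<star> x = scale ((- 1) ^ (m * n)) (x \<star> y)"
  using assms(2) unfolding sym_part_def
proof (induction rule: free_mod_induct)
  case (single b c)
  show ?case
    using assms(1) unfolding sym_part_def
  proof (induction rule: free_mod_induct)
    case (single a p)
    then show ?case
      using koszul_coeff_swap[OF order, of deg b a, where ?'r = 'r]
        in_gmons_mdeg[OF single] in_gmons_mdeg[OF \<open>b \<in> _\<close>]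
      by (simp add: mul_single add.commute mult_ac)
  qed (auto simp: mul_add_left mul_add_right scale_add_right)
qed (auto simp: mul_add_left mul_add_right scale_add_right)

lemma gmons_add:
  assumes "m \<in> gmons deg G k" "n \<in> gmons deg G l"
    and "\<not> (\<exists>g. g \<in># m \<and> g \<in># n \<and> odd (deg g))"
  shows "m + n \<in> gmons deg G (k + l)"
proof -
  have "count m g + count n g \<le> 1" if "g \<in> G" "odd (deg g)" for g
  proof -
    have "count m g = 0 \<or> count n g = 0"
      using assms(3) that by (auto simp: not_in_iff)
    moreover have "count m g \<le> 1" "count n g \<le> 1"
      using assms(1,2) that by (auto simp: gmons_def)
    ultimately show ?thesis by auto
  qed
  then show ?thesis using assms(1,2) by (auto simp: gmons_def)
qed

lemma mul_in:
  assumes "x \<in> sym_part deg G m" "y \<in> sym_part deg G n"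
  shows "x \<star> y \<in> sym_part deg G (m + n)"
  using assms(1) unfolding sym_part_def
proof (induction rule: free_mod_induct)
  case (single b c)
  show ?case
    using assms(2) unfolding sym_part_def
  proof (induction rule: free_mod_induct)
    case (single a p)
    then show ?case
    proof (cases "\<exists>g. g \<in># b \<and> g \<in># a \<and> odd (deg g)")
      case True
      then show ?thesis by (auto simp: mul_single koszul_coeff_def)
    next
      case False
      with single \<open>b \<in> _\<close> show ?thesis
        by (auto simp: mul_single intro!: free_mod_single gmons_add)
    qed
  qed (auto simp: mul_add_right)
qed (auto simp: mul_add_left)

lemma gmons_single [simp]: "{#g#} \<in> gmons deg G n \<longleftrightarrow> g \<in> G \<and> deg g = n"
  by (auto simp: gmons_def)

lemma gmons_empty [simp]: "{#} \<in> gmons deg G n \<longleftrightarrow> n = 0"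
  by (auto simp: gmons_def)

text \<open>Prepares peeling off one generator. The last conclusion, that a removed odd generator
  does not remain in \<open>m\<close>, makes the sign between the two factors invertible.\<close>

lemma gmons_add_mset:
  assumes "add_mset g m \<in> gmons deg G n"
  shows "g \<in> G" "m \<in> gmons deg G (n - deg g)" "n = deg g + (n - deg g)"
    "\<not> (g \<in># m \<and> odd (deg g))"
proof -
  have c: "count (add_mset g m) h \<le> 1" if "h \<in> G" "odd (deg h)" for h
    using assms that unfolding gmons_def by blast
  show "g \<in> G" "n = deg g + (n - deg g)" using assms by (auto simp: gmons_def)
  have "count m h \<le> 1" if "h \<in> G" "odd (deg h)" for h
    using c[OF that] by (auto split: if_splits)
  then show "m \<in> gmons deg G (n - deg g)" using assms by (auto simp: gmons_def)
  show "\<not> (g \<in># m \<and> odd (deg g))"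
    using c[of g] \<open>g \<in> G\<close> by (auto simp flip: count_greater_zero_iff)
qed

text \<open>The sign between \<open>g\<close> and \<open>m\<close> is its own inverse, so it can be
  moved to the other side of \<open>mon_mul\<close>. Iterating this writes every monomial as a
  product of generators up to sign.\<close>

lemma mon_add_mset:
  assumes "\<not> (g \<in># m \<and> odd (deg g))"
  shows "mon (add_mset g m) = scale (\<kappa> {#g#} m) (mon {#g#} \<star> (mon m :: _ \<Rightarrow>\<^sub>0 'r::comm_ring_1))"
  using koszul_coeff_square[of "{#g#}" m deg r, where ?'r = 'r] assms by (auto simp: mul_single)

text \<open>Monomials are reduced to left multiplication by a generator, and linearity does the
  rest. The predicate carries the degree because the signs in the Leibniz rule depend on it.\<close>

lemma sym_induct [consumes 1, case_names zero one gen add scale]: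
  assumes "x \<in> sym_part deg G n"
    and "\<And>n. P n 0"
    and "P 0 (mon {#})"
    and "\<And>g n x. g \<in> G \<Longrightarrow> x \<in> sym_part deg G n \<Longrightarrow> P n x \<Longrightarrow> P (deg g + n) (mon {#g#} \<star> x)"
    and "\<And>n x y. x \<in> sym_part deg G n \<Longrightarrow> y \<in> sym_part deg G n \<Longrightarrow> P n x \<Longrightarrow> P n y \<Longrightarrow> P n (x + y)"
    and "\<And>n c x. x \<in> sym_part deg G n \<Longrightarrow> P n x \<Longrightarrow> P n (scale c x)"
  shows "P n x"
proof -
  have mon: "P n (mon m)" if "m \<in> gmons deg G n" for m n
    using that
  proof (induction m arbitrary: n)
    case empty
    then show ?case using assms(3) by simp
  next
    case (add g m)
    note * = gmons_add_mset[OF add.prems]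
    have "mon m \<in> sym_part deg G (n - deg g)" using *(2) by (auto simp: sym_part_def)
    moreover from this have "mon {#g#} \<star> mon m \<in> sym_part deg G (deg g + (n - deg g))"
      using *(1) by (intro mul_in) (auto simp: sym_part_def intro!: free_mod_single)
    ultimately show ?case
      using *(1,2,3) add.IH[OF *(2)] assms(4,6) mon_add_mset[OF *(4)] by metis
  qed
  show ?thesis
    using assms(1) unfolding sym_part_def
  proof (induction rule: free_mod_induct)
    case (single b c)
    then show ?case
      using assms(6)[of "mon b" n c] mon[of b n] by (auto simp: sym_part_def)
  qed (use assms in \<open>auto simp: sym_part_def\<close>)
qed

lemma sym_part_closed:
  "0 \<in> sym_part deg G n"
  "x \<in> sym_part deg G n \<Longrightarrow> y \<in> sym_part deg G n \<Longrightarrow> x + y \<in> sym_part deg G n"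
  "x \<in> sym_part deg G n \<Longrightarrow> scale c x \<in> sym_part deg G n"
  "g \<in> G \<Longrightarrow> mon {#g#} \<in> sym_part deg G (deg g)"
  "mon {#} \<in> sym_part deg G 0"
  by (auto simp: sym_part_def intro!: free_mod_single)

lemma graded_comm_algebra_sym_part:
  "graded_comm_algebra (sym_part deg G) (\<star>) (sym_scalar 1)"
  unfolding graded_comm_algebra_def sym_scalar_def
  by (intro conjI allI ballI mul_commute)
     (auto simp: sym_part_closed mul_in mul_assoc linear_on_def mul_add_right)

end

section \<open>Derivations with prescribed values on the generators\<close>

locale generator_map = graded_sym deg r
  for deg :: "'g \<Rightarrow> nat" and r :: "'g rel" +
  fixes G :: "'g set" and dg :: "'g \<Rightarrow> ('g multiset \<Rightarrow>\<^sub>0 'r::comm_ring_1)"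
  assumes deg_pos: "g \<in> G \<Longrightarrow> 0 < deg g"
    and dg_in: "g \<in> G \<Longrightarrow> dg g \<in> sym_part deg G (deg g - 1)"
begin

abbreviation A :: "nat \<Rightarrow> ('g multiset \<Rightarrow>\<^sub>0 'r) set" where "A \<equiv> sym_part deg G"

text \<open>The sum over the multiset counts a generator with its multiplicity, so a power of an
  even generator is differentiated as in calculus. One linear map serves all degrees.\<close>

definition Der :: "('g multiset \<Rightarrow>\<^sub>0 'r) \<Rightarrow> ('g multiset \<Rightarrow>\<^sub>0 'r)" where
  "Der = lin_ext (\<lambda>m. \<Sum>g\<in>#m. scale (\<kappa> {#g#} (m - {#g#})) (dg g \<star> mon (m - {#g#})))"

lemma Der_mon: "Der (mon m) = (\<Sum>g\<in>#m. scale (\<kappa> {#g#} (m - {#g#})) (dg g \<star> mon (m - {#g#})))"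
  by (simp add: Der_def)

lemma mul_one_right: "x \<in> A n \<Longrightarrow> x \<star> mon {#} = x"
  using mul_commute[OF sym_part_closed(5), of x G n] by simp

lemma Der_add: "Der (x + y) = Der x + Der y"
  and Der_scale: "Der (scale c x) = scale c (Der x)"
  and Der_zero [simp]: "Der 0 = 0"
  and Der_one [simp]: "Der (mon {#}) = 0"
  by (simp_all add: Der_def lin_ext_add lin_ext_scale)

lemma Der_gen: "g \<in> G \<Longrightarrow> Der (mon {#g#}) = dg g"
  by (simp add: Der_mon mul_one_right[OF dg_in])

text \<open>The two ways of splitting off \<open>g\<close> and \<open>h\<close> are compared through
  \<open>koszul_cocycle\<close>, and exchanging \<open>g\<close> with \<open>h\<close> costs the
  sign of \<open>koszul_coeff_swap\<close>. Only the signs of \<open>g\<close> have to be inverted,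
  so the hypothesis concerns \<open>g\<close> alone.\<close>

lemma koszul_exchange:
  assumes "\<not> (odd (deg g) \<and> (g \<in># m \<or> g = h))"
  shows "\<kappa> {#g#} (add_mset h m) * \<kappa> {#h#} (add_mset g m) =
    ((- 1) ^ (deg g * deg h) * \<kappa> {#h#} m * \<kappa> {#g#} m :: 'r)"
proof -
  let ?s = "(- 1) ^ (deg g * deg h) :: 'r"
  have 1: "\<kappa> {#g#} {#h#} * \<kappa> ({#g#} + {#h#}) m = (\<kappa> {#h#} m * \<kappa> {#g#} (add_mset h m) :: 'r)"
    using koszul_cocycle[of deg r "{#g#}" "{#h#}" m] by simp
  have 2: "\<kappa> {#h#} {#g#} * \<kappa> ({#g#} + {#h#}) m = (\<kappa> {#g#} m * \<kappa> {#h#} (add_mset g m) :: 'r)"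
    using koszul_cocycle[of deg r "{#h#}" "{#g#}" m] by (simp add: add_mset_commute)
  have 3: "\<kappa> {#h#} {#g#} = (?s * \<kappa> {#g#} {#h#} :: 'r)"
    using koszul_coeff_swap[OF order, of deg "{#h#}" "{#g#}"] by simp
  have 4: "\<kappa> {#g#} m * \<kappa> {#g#} m = (1 :: 'r)"
    and 5: "\<kappa> {#g#} (add_mset h m) * \<kappa> {#g#} (add_mset h m) = (1 :: 'r)"
    using assms by (auto intro!: koszul_coeff_square)
  have 6: "?s * (\<kappa> {#h#} m * \<kappa> {#g#} (add_mset h m)) = \<kappa> {#g#} m * \<kappa> {#h#} (add_mset g m)"
    using 1 2 3 by (metis mult.assoc)
  have "\<kappa> {#g#} (add_mset h m) * \<kappa> {#h#} (add_mset g m) =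
      \<kappa> {#g#} (add_mset h m) * \<kappa> {#g#} m * (\<kappa> {#g#} m * \<kappa> {#h#} (add_mset g m) :: 'r)"
    using 4 by (metis mult.assoc mult_1_right)
  also have "\<dots> = ?s * \<kappa> {#h#} m * \<kappa> {#g#} m *
      (\<kappa> {#g#} (add_mset h m) * \<kappa> {#g#} (add_mset h m))"
    unfolding 6 [symmetric] by (simp only: mult_ac)
  finally show ?thesis using 5 by simp
qed

text \<open>Moving \<open>mon {#g#}\<close> past \<open>dg h\<close>, which has degree
  \<open>deg h - 1\<close>, gives the exponent \<open>(deg h - 1) * deg g\<close>; the Leibniz sign
  completes it to \<open>deg g * deg h\<close>. Positivity of \<open>deg h\<close> guards the
  truncated subtraction.\<close>

lemma gen_mul_dg:
  assumes "g \<in> G" "h \<in> G"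
  shows "scale ((- 1) ^ deg g) (mon {#g#} \<star> (dg h \<star> x)) =
    scale ((- 1) ^ (deg g * deg h)) (dg h \<star> (mon {#g#} \<star> x))"
proof -
  have "mon {#g#} \<star> dg h = scale ((- 1) ^ ((deg h - 1) * deg g)) (dg h \<star> mon {#g#})"
    by (rule mul_commute[OF dg_in[OF assms(2)] sym_part_closed(4)[OF assms(1)]])
  moreover have "(- 1 :: 'r) ^ deg g * (- 1) ^ ((deg h - 1) * deg g) = (- 1) ^ (deg g * deg h)"
    using deg_pos[OF assms(2)] by (cases "deg h") (simp_all add: power_add mult.commute)
  ultimately show ?thesis
    by (simp add: mult.commute flip: mul_assoc)
qed

text \<open>This is where the sign in \<open>Der\<close> is justified. If the product vanishes
  because the odd \<open>g\<close> already occurs in \<open>m\<close>, the two terms on the right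
  cancel; otherwise the sum that defines \<open>Der\<close> on \<open>add_mset g m\<close> is
  compared with the right-hand side term by term.\<close>

lemma Leibniz_gen_mon:
  assumes g: "g \<in> G" and m: "m \<in> gmons deg G n"
  shows "Der (mon {#g#} \<star> mon m) =
    dg g \<star> mon m + scale ((- 1) ^ deg g) (mon {#g#} \<star> Der (mon m))"
proof -
  let ?t = "\<lambda>h. scale ((- 1) ^ (deg g * deg h) * \<kappa> {#h#} (m - {#h#}) * \<kappa> {#g#} (m - {#h#}))
      (dg h \<star> mon (add_mset g (m - {#h#})))"
  have mG: "h \<in> G" if "h \<in># m" for h using m that by (auto simp: gmons_def)
  have "scale ((- 1) ^ deg g) (mon {#g#} \<star> Der (mon m)) =
      (\<Sum>h\<in>#m. scale (\<kappa> {#h#} (m - {#h#}))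
        (scale ((- 1) ^ deg g) (mon {#g#} \<star> (dg h \<star> mon (m - {#h#})))))"
    by (simp add: Der_mon mul_sum_mset scale_sum_mset mult.commute)
  also have "\<dots> = (\<Sum>h\<in>#m. ?t h)"
    by (intro arg_cong[where f = sum_mset] image_mset_cong)
       (simp add: gen_mul_dg[OF g mG] mon_mul mult_ac del: scale_single)
  finally have R: "scale ((- 1) ^ deg g) (mon {#g#} \<star> Der (mon m)) = (\<Sum>h\<in>#m. ?t h)" .
  show ?thesis
  proof (cases "odd (deg g) \<and> g \<in># m")
    case True
    then obtain m' where m': "m = add_mset g m'" by (metis mset_add)
    have "g \<notin># m'" using gmons_add_mset(4)[OF m[unfolded m']] True by auto
    \<comment> \<open>Removing \<open>h\<close> leaves the odd \<open>g\<close> in the monomial, so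
      the coefficient with \<open>g\<close> is zero. Only the summand \<open>h = g\<close> survives,
      and its sign is that of the odd number \<open>deg g * deg g\<close>.\<close>
    have "?t h = 0" if "h \<in># m'" for h
    proof -
      have "g \<in># m - {#h#}" using that \<open>g \<notin># m'\<close> m' by auto
      then show ?thesis using True by (simp add: koszul_coeff_odd[of g])
    qed
    then have "(\<Sum>h\<in>#m'. ?t h) = 0" by (simp add: sum_mset.neutral)
    moreover have "?t g = - (dg g \<star> mon m)"
      using True \<open>g \<notin># m'\<close> koszul_coeff_square[of "{#g#}" m' deg r, where ?'r = 'r]
      by (simp add: m' mult.assoc)
    ultimately have "(\<Sum>h\<in>#m. ?t h) = - (dg g \<star> mon m)"
      by (simp add: m')
    then show ?thesis
      using True R by (simp add: mon_mul koszul_coeff_odd[of g])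
  next
    case False
    have sq: "\<kappa> {#g#} m * \<kappa> {#g#} m = (1 :: 'r)"
      using False by (auto intro!: koszul_coeff_square)
    let ?u = "\<lambda>h. scale (\<kappa> {#h#} (add_mset g m - {#h#})) (dg h \<star> mon (add_mset g m - {#h#}))"
    have "Der (mon {#g#} \<star> mon m) = scale (\<kappa> {#g#} m) (Der (mon (add_mset g m)))"
      by (simp add: mon_mul Der_scale del: scale_single)
    \<comment> \<open>The summand split off for the added \<open>g\<close> carries the square of
      \<open>\<kappa> {#g#} m\<close>, which is one.\<close>
    also have "\<dots> = dg g \<star> mon m + (\<Sum>h\<in>#m. scale (\<kappa> {#g#} m) (?u h))"
      by (simp add: Der_mon scale_add_right sq scale_sum_mset)
    also have "(\<Sum>h\<in>#m. scale (\<kappa> {#g#} m) (?u h)) = (\<Sum>h\<in>#m. ?t h)"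
    proof (intro arg_cong[where f = sum_mset] image_mset_cong)
      fix h assume h: "h \<in># m"
      then obtain m' where m': "m = add_mset h m'" by (metis mset_add)
      have *: "add_mset g m - {#h#} = add_mset g m'" by (simp add: m' add_mset_commute)
      have "\<not> (odd (deg g) \<and> (g \<in># m' \<or> g = h))" using False m' by auto
      from koszul_exchange[OF this]
      show "scale (\<kappa> {#g#} m) (?u h) = ?t h"
        unfolding * by (simp add: m')
    qed
    finally show ?thesis using R by simp
  qed
qed

lemma Leibniz_gen:
  assumes g: "g \<in> G" and x: "x \<in> A n"
  shows "Der (mon {#g#} \<star> x) = dg g \<star> x + scale ((- 1) ^ deg g) (mon {#g#} \<star> Der x)"
  using x unfolding sym_part_def
proof (induction rule: free_mod_induct)
  case (single b c)
  have "single b c = scale c (mon b)" by simp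
  then show ?case
    using Leibniz_gen_mon[OF g single]
    by (simp only: mul_scale_right Der_scale scale_add_right scale_scale mult.commute)
qed (auto simp: mul_add_right Der_add scale_add_right)

text \<open>Truncated subtraction makes \<open>A (0 - 1)\<close> equal to \<open>A 0\<close>, so
  vanishing in degree 0 is proved simultaneously: in the step with \<open>n = 0\<close> the summand
  \<open>mon {#g#} \<star> Der x\<close> fits the claimed degree only because it is zero.\<close>

lemma Der_in_aux: "x \<in> A n \<Longrightarrow> Der x \<in> A (n - 1) \<and> (n = 0 \<longrightarrow> Der x = 0)"
proof (induction rule: sym_induct)
  case (gen g n x)
  have 1: "dg g \<star> x \<in> A (deg g - 1 + n)" using gen by (intro mul_in dg_in)
  have "mon {#g#} \<star> Der x \<in> A (deg g + n - 1)"
  proof (cases n)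
    case (Suc k)
    then have "mon {#g#} \<star> Der x \<in> A (deg g + (n - 1))"
      using gen by (intro mul_in sym_part_closed) auto
    then show ?thesis using Suc by simp
  qed (use gen in \<open>simp add: sym_part_closed\<close>)
  then show ?case
    using 1 deg_pos[OF \<open>g \<in> G\<close>] Leibniz_gen[OF gen(1,2)] by (auto intro!: sym_part_closed)
qed (auto simp: sym_part_closed Der_add Der_scale)

lemma Der_in: "x \<in> A n \<Longrightarrow> Der x \<in> A (n - 1)"
  and Der_degree_0: "x \<in> A 0 \<Longrightarrow> Der x = 0"
  using Der_in_aux by auto

lemma linear_on_Der: "linear_on (A n) (A (n - 1)) Der"
  using Der_in by (simp add: linear_on_def Der_add Der_scale)

text \<open>Peeling generators off the first factor reduces the rule to \<open>Leibniz_gen\<close>,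
  with associativity regrouping the factors.\<close>

lemma Leibniz:
  assumes "x \<in> A k" "y \<in> A l"
  shows "Der (x \<star> y) = Der x \<star> y + scale ((- 1) ^ k) (x \<star> Der y)"
  using assms(1)
proof (induction rule: sym_induct)
  case (gen g n x)
  have "Der ((mon {#g#} \<star> x) \<star> y) = Der (mon {#g#} \<star> (x \<star> y))"
    by (simp add: mul_assoc)
  also have "\<dots> = dg g \<star> (x \<star> y) + scale ((- 1) ^ deg g) (mon {#g#} \<star> Der (x \<star> y))"
    by (intro Leibniz_gen[where n = "n + l"] mul_in gen(1,2) assms(2))
  also have "\<dots> = Der (mon {#g#} \<star> x) \<star> y +
      scale ((- 1) ^ (deg g + n)) ((mon {#g#} \<star> x) \<star> Der y)"
    unfolding Leibniz_gen[OF gen(1,2)] gen.IH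
    by (simp add: mul_add_right mul_add_left mul_assoc scale_add_right power_add add.assoc)
  finally show ?case .
qed (auto simp: mul_add_left Der_add Der_scale scale_add_right mult.commute)

lemma leibniz_at_Der: "leibniz_at A (\<star>) (\<lambda>_. Der) j"
  using Leibniz unfolding leibniz_at_def by blast

text \<open>Peeling off a generator never leaves the degrees up to \<open>N\<close>, so the values
  on generators of degree at most \<open>N\<close> decide. This serves both to recognise existing
  differentials as restrictions of \<open>Der\<close> and to prove that the next one is
  unique.\<close>

lemma Leibniz_unique:
  assumes lin: "\<And>j. 1 \<le> j \<Longrightarrow> j \<le> N \<Longrightarrow> linear_on (A j) (A (j - 1)) (D j)"
    and leib: "\<And>j. 1 \<le> j \<Longrightarrow> j \<le> N \<Longrightarrow> leibniz_at A (\<star>) D j"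
    and zero: "\<And>x. x \<in> A 0 \<Longrightarrow> D 0 x = 0"
    and gen: "\<And>g. g \<in> G \<Longrightarrow> deg g \<le> N \<Longrightarrow> D (deg g) (mon {#g#}) = dg g"
    and "x \<in> A n" "n \<le> N"
  shows "D n x = Der x"
  using \<open>x \<in> A n\<close> \<open>n \<le> N\<close>
proof (induction rule: sym_induct)
  case (zero n)
  then show ?case
    using assms(3)[of 0] lin[of n] linear_on_zero[of _ _ "D n"] sym_part_closed(1)[of G 0]
    by (cases n) (auto simp: sym_part_def)
next
  case one
  then show ?case using zero sym_part_closed(5) by auto
next
  case (gen g n x)
  have "1 \<le> deg g + n" using deg_pos[OF gen(1)] by simp
  from leib[OF this gen(4)] have
    "D (deg g + n) (mon {#g#} \<star> x) =
       D (deg g) (mon {#g#}) \<star> x + scale ((- 1) ^ deg g) (mon {#g#} \<star> D n x)"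
    using gen sym_part_closed(4)[OF gen(1)] unfolding leibniz_at_def
    by (metis add_diff_cancel_left' le_add1)
  then show ?case
    using gen assms(4) Leibniz_gen[OF gen(1,2)] by auto
next
  case (add n x y)
  then show ?case
    using lin[of n] assms(3) sym_part_closed(2)[of _ G 0] by (cases n) (auto simp: Der_add linear_on_add)
next
  case (scale n c x)
  then show ?case
    using lin[of n] assms(3) sym_part_closed(3)[of _ G 0] linear_on_scale[of "A n" "A (n - 1)" "D n" x c]
    by (cases n) (auto simp: Der_scale)
qed

text \<open>The mixed terms \<open>dg g \<star> Der x\<close> appear with the signs of
  \<open>deg g - 1\<close> and \<open>deg g\<close> and cancel; the remaining terms vanish by
  hypothesis and by induction.\<close>

lemma Der_square_zero:
  assumes "\<And>g. g \<in> G \<Longrightarrow> Der (dg g) = 0" "x \<in> A n"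
  shows "Der (Der x) = 0"
  using assms(2)
proof (induction rule: sym_induct)
  case (gen g n x)
  have g: "dg g \<in> A (deg g - 1)" "mon {#g#} \<in> A (deg g)"
    using dg_in sym_part_closed(4) gen(1) by blast+
  have "Der (Der (mon {#g#} \<star> x)) = scale ((- 1) ^ (deg g - 1)) (dg g \<star> Der x) +
     scale ((- 1) ^ deg g) (dg g \<star> Der x)"
    using assms(1)[OF gen(1)] gen
    by (simp add: Leibniz_gen[OF gen(1,2)] Der_add Der_scale Leibniz[OF g(1) gen(2)]
        Leibniz_gen[OF gen(1) Der_in[OF gen(2)]])
  then show ?case using deg_pos[OF gen(1)] by (cases "deg g") auto
qed (auto simp: Der_add Der_scale)

end

section \<open>The direct sum decomposition of \<open>P\<^sub>j\<close>\<close>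

definition all_gens :: "(nat \<Rightarrow> 'b set) \<Rightarrow> 'b gen set" where
  "all_gens B = (\<Union>i. gens B i)"

definition old_mons :: "(nat \<Rightarrow> 'b set) \<Rightarrow> nat \<Rightarrow> 'b gen multiset set" where
  "old_mons B j = (case j of 0 \<Rightarrow> {} | Suc i \<Rightarrow> gmons gdeg (gens B i) (Suc i))"

lemma P_old_eq: "P_old B j = free_mod (old_mons B j)"
  by (cases j) (auto simp: P_old_def old_mons_def P_stage_def sym_part_def)

lemma gdeg_Susp: "gdeg (Susp m) = Suc (mdeg gdeg m)"
  by (simp add: mdeg_def)

declare gdeg.simps(2) [simp del] gdeg_Susp [simp]

text \<open>One recursion for all stages: the special clause for stage 1 fits in because
  \<open>old_mons B 0\<close> is empty.\<close>

lemma gens_Suc: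
  "gens B (Suc j) = gens B j \<union> Base (Suc j) ` B (Suc j) \<union> Susp ` old_mons B j"
  by (cases j) (auto simp: old_mons_def)

lemma gens_mono: "i \<le> j \<Longrightarrow> gens B i \<subseteq> gens B j"
  by (rule lift_Suc_mono_le[of "gens B"]) (auto simp: gens_Suc)

lemma old_mons_mdeg: "m \<in> old_mons B j \<Longrightarrow> mdeg gdeg m = j"
  by (auto simp: old_mons_def gmons_def split: nat.splits)

lemma gens_gdeg:
  assumes "g \<in> gens B i"
  shows "0 < gdeg g" "gdeg g \<le> i" "g \<in> gens B (gdeg g)"
proof -
  have "0 < gdeg g \<and> gdeg g \<le> i \<and> g \<in> gens B (gdeg g)"
    using assms by (induction i) (auto simp: gens_Suc old_mons_mdeg simp del: gens.simps(2,3))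
  then show "0 < gdeg g" "gdeg g \<le> i" "g \<in> gens B (gdeg g)" by auto
qed

lemma all_gens_gdeg:
  "g \<in> all_gens B \<Longrightarrow> 0 < gdeg g"
  "g \<in> all_gens B \<Longrightarrow> gdeg g \<le> i \<Longrightarrow> g \<in> gens B i"
  using gens_gdeg gens_mono unfolding all_gens_def by blast+

lemma gens_subset_all_gens: "gens B i \<subseteq> all_gens B"
  by (auto simp: all_gens_def)

text \<open>The multiplicity condition speaks only of generators in the chosen set, so a larger set
  adds conditions. They hold because the added generators do not occur in the monomial.\<close>

lemma gmons_mono:
  assumes "G \<subseteq> G'" shows "gmons deg G n \<subseteq> gmons deg G' n"
proof
  fix m assume m: "m \<in> gmons deg G n"
  have "count m g \<le> 1" if "odd (deg g)" for g
    using m that by (cases "g \<in># m") (auto simp: gmons_def not_in_iff)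
  with m assms show "m \<in> gmons deg G' n" by (auto simp: gmons_def)
qed

lemma gdeg_le_mdeg: "g \<in># m \<Longrightarrow> deg g \<le> mdeg deg m"
  by (auto dest!: multi_member_split)

text \<open>A generator in a monomial of degree \<open>n\<close> has degree at most \<open>n\<close>
  and is therefore present at stage \<open>n\<close>. Hence the union of the stages is attained at a
  finite stage in each degree, and \<open>P_part\<close> is a single symmetric algebra.\<close>

lemma gmons_all_gens: "gmons gdeg (all_gens B) n = gmons gdeg (gens B n) n"
proof
  show "gmons gdeg (gens B n) n \<subseteq> gmons gdeg (all_gens B) n"
    by (intro gmons_mono gens_subset_all_gens)
  show "gmons gdeg (all_gens B) n \<subseteq> gmons gdeg (gens B n) n"
  proof
    fix m assume m: "m \<in> gmons gdeg (all_gens B) n"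
    then have "set_mset m \<subseteq> gens B n"
      using gdeg_le_mdeg[of _ m gdeg] all_gens_gdeg(2)[of _ B n] by (auto simp: gmons_def)
    with m show "m \<in> gmons gdeg (gens B n) n"
      using gens_subset_all_gens[of B n] by (auto simp: gmons_def)
  qed
qed

lemma P_part_eq: "P_part B n = sym_part gdeg (all_gens B) n"
proof
  show "P_part B n \<subseteq> sym_part gdeg (all_gens B) n"
    unfolding P_part_def P_stage_def sym_part_def
    by (intro UN_least free_mod_mono gmons_mono gens_subset_all_gens)
  show "sym_part gdeg (all_gens B) n \<subseteq> P_part B n"
    unfolding P_part_def P_stage_def sym_part_def gmons_all_gens by blast
qed

lemma P_part_free: "P_part B n = free_mod (gmons gdeg (all_gens B) n)"
  by (simp add: P_part_eq sym_part_def)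

lemma all_gens_iff:
  "Base j e \<in> all_gens B \<longleftrightarrow> 1 \<le> j \<and> e \<in> B j"
  "Susp m \<in> all_gens B \<longleftrightarrow> m \<in> old_mons B (mdeg gdeg m)"
proof -
  have "Base j e \<in> gens B i \<longleftrightarrow> 1 \<le> j \<and> j \<le> i \<and> e \<in> B j" for i
    by (induction i) (auto simp: gens_Suc le_Suc_eq simp del: gens.simps(2,3))
  then show "Base j e \<in> all_gens B \<longleftrightarrow> 1 \<le> j \<and> e \<in> B j"
    by (auto simp: all_gens_def)
  have "Susp m \<in> gens B i \<longleftrightarrow> mdeg gdeg m < i \<and> m \<in> old_mons B (mdeg gdeg m)" for i
    by (induction i) (auto simp: gens_Suc less_Suc_eq old_mons_mdeg simp del: gens.simps(2,3))
  then show "Susp m \<in> all_gens B \<longleftrightarrow> m \<in> old_mons B (mdeg gdeg m)"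
    by (auto simp: all_gens_def)
qed

lemma gmons_0: "(\<And>g. g \<in> G \<Longrightarrow> 0 < deg g) \<Longrightarrow> gmons deg G 0 = {{#}}"
  by (auto simp: gmons_def mdeg_def) (metis multiset_nonemptyE subsetD less_irrefl)

text \<open>A factor outside stage \<open>n - 1\<close> has degree exactly \<open>n\<close>, and
  positivity of the degrees leaves no room for another factor, so the monomial is a single new
  generator. If there is no such factor, the monomial is old.\<close>

lemma gmons_gens_cases:
  assumes "m \<in> gmons gdeg (all_gens B) n"
  obtains (unit) "n = 0" "m = {#}"
  | (base) e where "1 \<le> n" "e \<in> B n" "m = {#Base n e#}"
  | (susp) m' where "1 \<le> n" "m' \<in> old_mons B (n - 1)" "m = {#Susp m'#}"
  | (old) "1 \<le> n" "m \<in> old_mons B n"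
proof (cases n)
  case 0
  then show ?thesis
    using assms unit gmons_0[of "all_gens B" gdeg] all_gens_gdeg(1) by auto
next
  case (Suc i)
  show ?thesis
  proof (cases "set_mset m \<subseteq> gens B i")
    case True
    then have "m \<in> gmons gdeg (gens B i) n"
      using assms gens_subset_all_gens[of B i] by (auto simp: gmons_def)
    then show ?thesis using old Suc by (simp add: old_mons_def)
  next
    case False
    then obtain g where g: "g \<in># m" "g \<notin> gens B i" by auto
    then obtain m' where m': "m = add_mset g m'" by (metis mset_add)
    have mem: "h \<in> all_gens B" if "h \<in># m" for h using assms that by (auto simp: gmons_def)
    then have gG: "g \<in> all_gens B" using g by auto
    have "gdeg g \<le> n" using gdeg_le_mdeg[OF g(1), of gdeg] assms by (simp add: gmons_def)
    moreover have "\<not> gdeg g \<le> i" using all_gens_gdeg(2)[OF gG] g by blast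
    ultimately have gn: "gdeg g = n" using Suc by auto
    have "m' = {#}"
    proof (rule ccontr)
      assume "m' \<noteq> {#}"
      then obtain h where h: "h \<in># m'" by auto
      then have "0 < gdeg h" using mem m' all_gens_gdeg(1) by auto
      moreover have "mdeg gdeg m = n" using assms by (simp add: gmons_def)
      ultimately show False using gdeg_le_mdeg[OF h, of gdeg] gn m' by simp
    qed
    with m' gG gn base susp show ?thesis
      by (cases g) (auto simp: all_gens_iff)
  qed
qed

section \<open>Inclusions and projections of the three summands\<close>

lemma incl_F_lin_ext: "incl_F j = lin_ext (\<lambda>e. mon (if j = 0 then {#} else {#Base j e#}))"
  by (simp add: incl_F_def basis_ext_eq_lin_ext)

lemma susp_lin_ext: "susp = lin_ext (\<lambda>m. mon {#Susp m#})"
  by (simp add: susp_def basis_ext_eq_lin_ext)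

text \<open>Degree 0 is treated apart because there the unit monomial stands for \<open>e0\<close>.
  The description by \<open>THE\<close> is unambiguous by injectivity of
  \<open>Base\<close>.\<close>

definition proj_F :: "'b \<Rightarrow> nat \<Rightarrow> ('b, 'r::comm_ring_1) alg \<Rightarrow> ('b \<Rightarrow>\<^sub>0 'r)" where
  "proj_F e0 j = lin_ext (\<lambda>m.
     if j = 0 then (if m = {#} then single e0 1 else 0)
     else if \<exists>e. m = {#Base j e#} then single (THE e. m = {#Base j e#}) 1 else 0)"

definition proj_susp :: "('b, 'r::comm_ring_1) alg \<Rightarrow> ('b, 'r) alg" where
  "proj_susp = lin_ext (\<lambda>m. if \<exists>m'. m = {#Susp m'#} then mon (THE m'. m = {#Susp m'#}) else 0)"

definition proj_old :: "(nat \<Rightarrow> 'b set) \<Rightarrow> nat \<Rightarrow> ('b, 'r::comm_ring_1) alg \<Rightarrow> ('b, 'r) alg" where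
  "proj_old B j = lin_ext (\<lambda>m. if m \<in> old_mons B j then mon m else 0)"

text \<open>A generator first appears at the stage of its own degree, whereas old monomials of that
  degree use the stage before. This keeps new and old summands apart.\<close>

lemma single_notin_old_mons: "{#g#} \<in> old_mons B j \<Longrightarrow> P"
  using gens_gdeg[of g B] by (cases j) (fastforce simp: old_mons_def gmons_def)+

lemma empty_notin_old_mons: "{#} \<in> old_mons B j \<Longrightarrow> P"
  by (cases j) (auto simp: old_mons_def gmons_def)

lemma old_mons_subset: "old_mons B j \<subseteq> gmons gdeg (all_gens B) j"
  using gmons_mono[OF gens_subset_all_gens, of gdeg B] by (cases j) (auto simp: old_mons_def)

lemma P_old_subset: "P_old B j \<subseteq> P_part B j"
  unfolding P_old_eq P_part_free by (intro free_mod_mono old_mons_subset)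

lemma P_old_0 [simp]: "P_old B 0 = {0}"
  by (simp add: P_old_eq old_mons_def)

lemma linear_on_proj:
  assumes "B 0 = {e0}"
  shows "linear_on (P_part B j) (free_mod (B j)) (proj_F e0 j)"
    and "linear_on (P_part B j) (P_old B (j - 1)) proj_susp"
    and "linear_on (P_part B j) (P_old B j) (proj_old B j)"
  unfolding P_part_free P_old_eq proj_F_def proj_susp_def proj_old_def
proof (safe intro!: linear_on_lin_ext)
  fix m assume "m \<in> gmons gdeg (all_gens B) j"
  then show "(if j = 0 then if m = {#} then single e0 1 else 0
      else if \<exists>e. m = {#Base j e#} then single (THE e. m = {#Base j e#}) 1 else 0) \<in> free_mod (B j)"
    "(if \<exists>m'. m = {#Susp m'#} then mon (THE m'. m = {#Susp m'#}) else 0) \<in> free_mod (old_mons B (j - 1))"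
    "(if m \<in> old_mons B j then mon m else 0) \<in> free_mod (old_mons B j)"
    by (cases rule: gmons_gens_cases; use assms in \<open>auto elim: single_notin_old_mons\<close>)+
qed

lemma linear_on_incl_F: "B 0 = {e0} \<Longrightarrow> linear_on (free_mod (B j)) (P_part B j) (incl_F j)"
  unfolding incl_F_lin_ext P_part_free
  by (intro linear_on_lin_ext free_mod_single) (auto simp: gmons_def all_gens_iff)

lemma linear_on_susp: "linear_on (P_old B (j - 1)) (P_part B j) susp"
proof (cases j)
  case 0
  then show ?thesis
    by (auto simp: linear_on_def susp_lin_ext P_part_free)
next
  case (Suc i)
  then show ?thesis
    unfolding susp_lin_ext P_part_free P_old_eq
    by (intro linear_on_lin_ext free_mod_single)
       (auto simp: gmons_def all_gens_iff old_mons_mdeg)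
qed

lemma incl_F_add: "incl_F j (x + y) = incl_F j x + incl_F j y"
  and incl_F_uminus: "incl_F j (- x) = - incl_F j x"
  and incl_F_diff: "incl_F j (x - y) = incl_F j x - incl_F j y"
  and incl_F_zero [simp]: "incl_F j 0 = 0"
  and susp_add: "susp (u + v) = susp u + susp v"
  and susp_uminus: "susp (- u) = - susp u"
  and susp_diff: "susp (u - v) = susp u - susp v"
  and susp_zero [simp]: "susp 0 = 0"
  by (simp_all add: incl_F_lin_ext susp_lin_ext lin_ext_add lin_ext_uminus lin_ext_diff)

lemma proj_zero [simp]: "proj_F e0 j 0 = 0" "proj_susp 0 = 0" "proj_old B j 0 = 0"
  by (simp_all add: proj_F_def proj_susp_def proj_old_def)

lemma proj_add:
  "proj_F e0 j (x + y) = proj_F e0 j x + proj_F e0 j y"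
  "proj_susp (x + y) = proj_susp x + proj_susp y"
  "proj_old B j (x + y) = proj_old B j x + proj_old B j y"
  by (simp_all add: proj_F_def proj_susp_def proj_old_def lin_ext_add)

text \<open>By linearity only monomials matter, and \<open>gmons_gens_cases\<close> puts each of
  them into one summand. Together with \<open>proj_sum\<close> this says that the sum is
  direct.\<close>

lemma proj_decomposition:
  assumes "B 0 = {e0}" "x \<in> P_part B j"
  shows "incl_F j (proj_F e0 j x) + susp (proj_susp x) + proj_old B j x = x"
  using assms(2) unfolding P_part_free
proof (induction rule: free_mod_induct)
  case zero
  then show ?case by simp
next
  case (single m c)
  from single show ?case
    by (cases rule: gmons_gens_cases)
       (auto simp: proj_F_def proj_susp_def proj_old_def incl_F_lin_ext susp_lin_ext
          elim: single_notin_old_mons empty_notin_old_mons)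
next
  case (add x y)
  have "incl_F j (proj_F e0 j (x + y)) + susp (proj_susp (x + y)) + proj_old B j (x + y) =
     (incl_F j (proj_F e0 j x) + susp (proj_susp x) + proj_old B j x) +
     (incl_F j (proj_F e0 j y) + susp (proj_susp y) + proj_old B j y)"
    by (simp add: proj_add incl_F_add susp_add)
  then show ?case using add by simp
qed

lemma proj_incl_F:
  assumes "B 0 = {e0}" "f \<in> free_mod (B j)"
  shows "proj_F e0 j (incl_F j f) = f" "proj_susp (incl_F j f) = 0" "proj_old B j (incl_F j f) = 0"
  using assms(2)
  by (induction rule: free_mod_induct;
      use assms(1) in \<open>auto simp: proj_F_def proj_susp_def proj_old_def incl_F_lin_ext lin_ext_add
        elim: single_notin_old_mons empty_notin_old_mons\<close>)+

lemma proj_susp_susp: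
  "proj_F e0 j (susp u) = 0" "proj_susp (susp u) = u" "proj_old B j (susp u) = 0"
proof -
  have "u \<in> free_mod UNIV" by (simp add: free_mod_def)
  then have "proj_F e0 j (susp u) = 0 \<and> proj_susp (susp u) = u \<and> proj_old B j (susp u) = 0"
    by (induction rule: free_mod_induct)
       (auto simp: proj_F_def proj_susp_def proj_old_def susp_lin_ext lin_ext_add
          elim: single_notin_old_mons)
  then show "proj_F e0 j (susp u) = 0" "proj_susp (susp u) = u" "proj_old B j (susp u) = 0" by auto
qed

lemma proj_P_old:
  assumes "v \<in> P_old B j"
  shows "proj_F e0 j v = 0" "proj_susp v = 0" "proj_old B j v = v"
  using assms unfolding P_old_eq
  by (induction rule: free_mod_induct;
      auto simp: proj_F_def proj_susp_def proj_old_def lin_ext_add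
        elim: single_notin_old_mons empty_notin_old_mons)+

lemma proj_sum:
  assumes "B 0 = {e0}" "f \<in> free_mod (B j)" "v \<in> P_old B j"
  shows "proj_F e0 j (incl_F j f + susp u + v) = f"
    and "proj_susp (incl_F j f + susp u + v) = u"
    and "proj_old B j (incl_F j f + susp u + v) = v"
  using assms by (simp_all add: proj_add proj_incl_F proj_susp_susp proj_P_old)

lemma P_part_0: "P_part (B :: nat \<Rightarrow> 'b set) 0 = range (sym_scalar :: 'r::comm_ring_1 \<Rightarrow> _)"
proof -
  have "P_part B 0 = (free_mod {{#}} :: ('b gen multiset \<Rightarrow>\<^sub>0 'r) set)"
    unfolding P_part_free by (subst gmons_0) (auto dest: all_gens_gdeg(1))
  also have "\<dots> = range sym_scalar"
  proof
    show "free_mod {{#}} \<subseteq> range (sym_scalar :: 'r \<Rightarrow> 'b gen multiset \<Rightarrow>\<^sub>0 'r)"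
    proof
      fix x :: "'b gen multiset \<Rightarrow>\<^sub>0 'r" assume "x \<in> free_mod {{#}}"
      then have "x = sym_scalar (lookup x {#})"
        by (intro poly_mapping_eqI) (auto simp: sym_scalar_def free_mod_iff lookup_single when_def)
      then show "x \<in> range sym_scalar" by blast
    qed
  qed (auto simp: sym_scalar_def)
  finally show ?thesis .
qed

section \<open>The inductive step\<close>

lemma linear_on_plus:
  "linear_on M (free_mod C) f \<Longrightarrow> linear_on M (free_mod C) g \<Longrightarrow>
    linear_on M (free_mod C) (\<lambda>x. f x + g x)"
  by (auto simp: linear_on_def scale_add_right)

text \<open>The product of factors of degrees \<open>k\<close> and \<open>j - k\<close> lies in
  degree \<open>j\<close>, so the rule at \<open>j\<close> sees only values on the carriers up to
  degree \<open>j\<close>. Maps may thus be exchanged for others that differ elsewhere.\<close>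

lemma leibniz_at_mono_cong:
  assumes "\<And>k x. k \<le> j \<Longrightarrow> x \<in> P_part B k \<Longrightarrow> D k x = E k x" "strict_linear_order r"
  shows "leibniz_at (P_part B) (sym_mult gdeg r) D j \<longleftrightarrow> leibniz_at (P_part B) (sym_mult gdeg r) E j"
proof -
  interpret graded_sym gdeg r by unfold_locales (rule assms(2))
  have "D j (sym_mult gdeg r y z) = E j (sym_mult gdeg r y z) \<and> D k y = E k y \<and> D (j - k) z = E (j - k) z"
    if "k \<le> j" "y \<in> P_part B k" "z \<in> P_part B (j - k)" for k y z
    using assms(1) mul_in[of y _ k z "j - k"] that by (simp add: P_part_eq)
  then show ?thesis unfolding leibniz_at_def by metis
qed

locale free_res = graded_sym gdeg r
  for r :: "'b gen rel" +
  fixes B :: "nat \<Rightarrow> 'b set" and e0 :: 'b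
    and d :: "nat \<Rightarrow> ('b \<Rightarrow>\<^sub>0 'r::comm_ring_1) \<Rightarrow> ('b \<Rightarrow>\<^sub>0 'r)"
    and \<pi> :: "'r \<Rightarrow> 's::comm_ring"
  assumes resolution: "free_resolution B e0 d \<pi>"
begin

abbreviation gmul (infixl "\<star>" 70) where "x \<star> y \<equiv> sym_mult gdeg r x y"
abbreviation P :: "nat \<Rightarrow> ('b, 'r) alg set" where "P \<equiv> P_part B"
abbreviation Old :: "nat \<Rightarrow> ('b, 'r) alg set" where "Old \<equiv> P_old B"
abbreviation F :: "nat \<Rightarrow> ('b \<Rightarrow>\<^sub>0 'r) set" where "F j \<equiv> free_mod (B j)"

lemma B0: "B 0 = {e0}"
  and d_linear: "1 \<le> j \<Longrightarrow> linear_on (F j) (F (j - 1)) (d j)"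
  and d_exact: "1 \<le> j \<Longrightarrow> {x \<in> F j. d j x = 0} = d (Suc j) ` F (Suc j)"
  and d_exact_0: "{x \<in> F 0. \<pi> (lookup x e0) = 0} = d 1 ` F 1"
  using resolution by (auto simp: free_resolution_def)

lemma d_zero: "1 \<le> j \<Longrightarrow> d j 0 = 0"
  using d_linear linear_on_zero by blast

lemma P_closed:
  "0 \<in> P n" "x \<in> P n \<Longrightarrow> y \<in> P n \<Longrightarrow> x + y \<in> P n" "x \<in> P n \<Longrightarrow> y \<in> P n \<Longrightarrow> x - y \<in> P n"
  by (auto simp: P_part_free)

lemma Old_closed: "0 \<in> Old n" "x \<in> Old n \<Longrightarrow> - x \<in> Old n"
  by (auto simp: P_old_eq)

lemma incl_F_in: "f \<in> F j \<Longrightarrow> incl_F j f \<in> P j"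
  using linear_on_in[OF linear_on_incl_F[where B = B and ?e0.0 = e0, OF B0]] .

lemma susp_in: "u \<in> Old (j - 1) \<Longrightarrow> susp u \<in> P j"
  using linear_on_in[OF linear_on_susp] .

lemma Old_in: "v \<in> Old j \<Longrightarrow> v \<in> P j"
  using P_old_subset by blast

text \<open>Stage 0 has no generators, hence no monomial of degree 1.\<close>

lemma Old_1: "Old 1 = {0}"
proof -
  have "old_mons B 1 = {}" by (auto simp: old_mons_def gmons_def)
  then show ?thesis by (simp add: P_old_eq)
qed

lemmas decomposition = proj_decomposition[where B = B and ?e0.0 = e0, OF B0]
  and linear_proj = linear_on_proj[where B = B and ?e0.0 = e0, OF B0]
  and linear_incl_F = linear_on_incl_F[where B = B and ?e0.0 = e0, OF B0]
  and proj_sums = proj_sum[where B = B and ?e0.0 = e0, OF B0]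

lemma proj_F_incl_F: "f \<in> F j \<Longrightarrow> proj_F e0 j (incl_F j f) = f"
  by (rule proj_incl_F(1)[where B = B, OF B0])

section \<open>Matrix entries read off from a differential\<close>

definition rho_of :: "(nat \<Rightarrow> ('b, 'r) alg \<Rightarrow> ('b, 'r) alg) \<Rightarrow> nat \<Rightarrow> ('b, 'r) alg \<Rightarrow> ('b \<Rightarrow>\<^sub>0 'r)" where
  "rho_of D j u = - proj_F e0 (j - 1) (D j (susp u))"

definition alpha_of :: "(nat \<Rightarrow> ('b, 'r) alg \<Rightarrow> ('b, 'r) alg) \<Rightarrow> nat \<Rightarrow> ('b, 'r) alg \<Rightarrow> ('b \<Rightarrow>\<^sub>0 'r)" where
  "alpha_of D j v = proj_F e0 (j - 1) (D j v)"

definition beta_of :: "(nat \<Rightarrow> ('b, 'r) alg \<Rightarrow> ('b, 'r) alg) \<Rightarrow> nat \<Rightarrow> ('b, 'r) alg \<Rightarrow> ('b, 'r) alg" where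
  "beta_of D j v = proj_susp (D j v)"

definition gamma_of :: "(nat \<Rightarrow> ('b, 'r) alg \<Rightarrow> ('b, 'r) alg) \<Rightarrow> nat \<Rightarrow> ('b, 'r) alg \<Rightarrow> ('b, 'r) alg" where
  "gamma_of D j v = proj_old B (j - 1) (D j v)"

text \<open>\<open>differential_upto\<close> without the matrix entries, which are recovered from \<open>D\<close> by projection.\<close>

definition admissible :: "nat \<Rightarrow> (nat \<Rightarrow> ('b, 'r) alg \<Rightarrow> ('b, 'r) alg) \<Rightarrow> bool" where
  "admissible i D \<longleftrightarrow> (\<forall>x\<in>P 0. D 0 x = 0) \<and>
     (\<forall>j\<in>{1..i}. linear_on (P j) (P (j - 1)) (D j) \<and>
        (\<forall>f\<in>F j. D j (incl_F j f) = incl_F (j - 1) (d j f)) \<and>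
        (\<forall>u\<in>Old (j - 1). D j (susp u) =
           incl_F (j - 1) (- rho_of D j u) + susp (- gamma_of D (j - 1) u) + u) \<and>
        leibniz_at P (\<star>) D j \<and> square_zero_at B D j)"

lemma admissibleD:
  assumes "admissible i D"
  shows admissible_0: "x \<in> P 0 \<Longrightarrow> D 0 x = 0"
    and admissible_linear: "1 \<le> j \<Longrightarrow> j \<le> i \<Longrightarrow> linear_on (P j) (P (j - 1)) (D j)"
    and admissible_incl_F: "1 \<le> j \<Longrightarrow> j \<le> i \<Longrightarrow> f \<in> F j \<Longrightarrow> D j (incl_F j f) = incl_F (j - 1) (d j f)"
    and admissible_susp: "1 \<le> j \<Longrightarrow> j \<le> i \<Longrightarrow> u \<in> Old (j - 1) \<Longrightarrow>
      D j (susp u) = incl_F (j - 1) (- rho_of D j u) + susp (- gamma_of D (j - 1) u) + u"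
    and admissible_leibniz: "1 \<le> j \<Longrightarrow> j \<le> i \<Longrightarrow> leibniz_at P (\<star>) D j"
    and admissible_square: "1 \<le> j \<Longrightarrow> j \<le> i \<Longrightarrow> x \<in> P j \<Longrightarrow> D (j - 1) (D j x) = 0"
  using assms by (auto simp: admissible_def square_zero_at_def)

lemma admissible_cong:
  assumes "\<And>j. j \<le> i \<Longrightarrow> D j = E j"
  shows "admissible i D \<longleftrightarrow> admissible i E"
proof -
  have "leibniz_at P (\<star>) D j \<longleftrightarrow> leibniz_at P (\<star>) E j" if "j \<le> i" for j
    using that assms order by (intro leibniz_at_mono_cong) auto
  moreover have "D (j - 1) = E (j - 1)" if "j \<le> i" for j
    using that assms by simp
  ultimately show ?thesis
    unfolding admissible_def square_zero_at_def rho_of_def gamma_of_def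
    using assms by (intro conj_cong ball_cong) auto
qed

lemma admissible_mono: "admissible i D \<Longrightarrow> j \<le> i \<Longrightarrow> admissible j D"
  by (auto simp: admissible_def)

text \<open>Form (A) prescribes only the columns of \<open>F\<close> and of the suspension. The
  third column may be any linear map, its entries being the components of
  \<open>D v\<close>.\<close>

lemma form_A_of_proj:
  assumes j: "1 \<le> j" and D: "linear_on (P j) (P (j - 1)) D"
    and F: "\<And>f. f \<in> F j \<Longrightarrow> D (incl_F j f) = incl_F (j - 1) (d j f)"
    and S: "\<And>u. u \<in> Old (j - 1) \<Longrightarrow> D (susp u) = incl_F (j - 1) (- \<rho> u) + susp (- \<gamma>' u) + u"
    and \<rho>: "linear_on (Old (j - 1)) (F (j - 1)) \<rho>"
  shows "form_A B d j D \<rho> (\<lambda>v. proj_F e0 (j - 1) (D v)) (\<lambda>v. proj_susp (D v)) \<gamma>'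
    (\<lambda>v. proj_old B (j - 1) (D v))"
proof -
  have DO: "linear_on (Old j) (P (j - 1)) D"
    using D P_old_subset by (rule linear_on_subset)
  have "D (incl_F j f + susp u + v) = incl_F (j - 1) (d j f - \<rho> u + proj_F e0 (j - 1) (D v)) +
      susp (- \<gamma>' u + proj_susp (D v)) + (u + proj_old B (j - 1) (D v))"
    if "f \<in> F j" "u \<in> Old (j - 1)" "v \<in> Old j" for f u v
  proof -
    have "D (incl_F j f + susp u + v) = D (incl_F j f) + D (susp u) + D v"
      using that D by (simp add: linear_on_add incl_F_in susp_in Old_in P_closed)
    also have "\<dots> = incl_F (j - 1) (d j f) + (incl_F (j - 1) (- \<rho> u) + susp (- \<gamma>' u) + u) +
      (incl_F (j - 1) (proj_F e0 (j - 1) (D v)) + susp (proj_susp (D v)) + proj_old B (j - 1) (D v))"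
      using that F S decomposition[of "D v" "j - 1"] linear_on_in[OF DO] by simp
    finally show ?thesis
      by (simp add: incl_F_add incl_F_diff incl_F_uminus susp_add susp_diff susp_uminus)
  qed
  then show ?thesis
    unfolding form_A_def
    using D \<rho> linear_on_comp[OF DO linear_proj(1)]
      linear_on_comp[OF DO linear_proj(2)] linear_on_comp[OF DO linear_proj(3)]
    by (simp add: numeral_2_eq_2)
qed

lemma rho_of_linear:
  assumes "linear_on (P j) (P (j - 1)) (D j)"
  shows "linear_on (Old (j - 1)) (F (j - 1)) (rho_of D j)"
  unfolding rho_of_def
  by (intro linear_on_neg linear_on_comp[OF linear_on_comp[OF linear_on_susp assms] linear_proj(1)])

lemma admissible_form_A:
  assumes "admissible i D" "1 \<le> j" "j \<le> i"
  shows "form_A B d j (D j) (rho_of D j) (alpha_of D j) (beta_of D j)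
    (gamma_of D (j - 1)) (gamma_of D j)"
  unfolding alpha_of_def beta_of_def gamma_of_def[of D j]
  by (rule form_A_of_proj[OF assms(2) admissible_linear[OF assms] admissible_incl_F[OF assms]
        admissible_susp[OF assms] rho_of_linear[where D = D and j = j, OF admissible_linear[OF assms]]])

text \<open>Setting two of the three arguments to zero isolates a column. Since
  \<open>form_A\<close> does not include linearity of \<open>\<gamma>'\<close>, its value at zero is
  assumed separately.\<close>

lemma form_A_D:
  assumes A: "form_A B d j D \<rho> \<alpha> \<beta> \<gamma>' \<gamma>" and "1 \<le> j" "\<gamma>' 0 = 0"
  shows form_A_incl_F: "f \<in> F j \<Longrightarrow> D (incl_F j f) = incl_F (j - 1) (d j f)"
    and form_A_susp: "u \<in> Old (j - 1) \<Longrightarrow> D (susp u) = incl_F (j - 1) (- \<rho> u) + susp (- \<gamma>' u) + u"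
    and form_A_old: "v \<in> Old j \<Longrightarrow> D v = incl_F (j - 1) (\<alpha> v) + susp (\<beta> v) + \<gamma> v"
proof -
  have z: "\<rho> 0 = 0" "\<alpha> 0 = 0" "\<beta> 0 = 0" "\<gamma> 0 = 0" "d j 0 = 0"
    using A d_zero[OF \<open>1 \<le> j\<close>] unfolding form_A_def P_old_eq by (auto intro: linear_on_zero)
  have D: "D (incl_F j f + susp u + v) =
      incl_F (j - 1) (d j f - \<rho> u + \<alpha> v) + susp (- \<gamma>' u + \<beta> v) + (u + \<gamma> v)"
    if "f \<in> F j" "u \<in> Old (j - 1)" "v \<in> Old j" for f u v
    using A that by (simp add: form_A_def)
  show "f \<in> F j \<Longrightarrow> D (incl_F j f) = incl_F (j - 1) (d j f)"
    using D[of f 0 0] z assms(3) by (simp add: Old_closed)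
  show "u \<in> Old (j - 1) \<Longrightarrow> D (susp u) = incl_F (j - 1) (- \<rho> u) + susp (- \<gamma>' u) + u"
    using D[of 0 u 0] z assms(3) by (simp add: Old_closed)
  show "v \<in> Old j \<Longrightarrow> D v = incl_F (j - 1) (\<alpha> v) + susp (\<beta> v) + \<gamma> v"
    using D[of 0 0 v] z assms(3) by (simp add: Old_closed)
qed

text \<open>The decomposition is direct, so on the old parts the entries of a matrix of form (A) are
  determined by the map. Arbitrary given entries can then be replaced by the projections.\<close>

lemma form_A_entries:
  assumes A: "form_A B d j (D j) \<rho> \<alpha> \<beta> \<gamma>' \<gamma>" and j: "1 \<le> j" "\<gamma>' 0 = 0"
  shows "u \<in> Old (j - 1) \<Longrightarrow> \<rho> u = rho_of D j u"
    and "v \<in> Old j \<Longrightarrow> \<alpha> v = alpha_of D j v"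
    and "v \<in> Old j \<Longrightarrow> \<gamma> v = gamma_of D j v"
proof -
  have lin: "linear_on (Old (j - 1)) (F (j - 1)) \<rho>" "linear_on (Old j) (F (j - 1)) \<alpha>"
    "linear_on (Old j) (Old (j - 1)) \<gamma>"
    using A by (auto simp: form_A_def)
  show "\<rho> u = rho_of D j u" if "u \<in> Old (j - 1)"
    unfolding rho_of_def form_A_susp[OF A j that]
    using linear_on_in[OF lin(1) that] that by (subst proj_sums) auto
  show "\<alpha> v = alpha_of D j v" "\<gamma> v = gamma_of D j v" if "v \<in> Old j"
    unfolding alpha_of_def gamma_of_def form_A_old[OF A j that]
    using linear_on_in[OF lin(2) that] linear_on_in[OF lin(3) that] by (simp_all add: proj_sums del: One_nat_def)
qed

lemma differential_upto_gamma:
  assumes "differential_upto B d r i D \<rho> \<alpha> \<beta> \<gamma>" "j \<le> i"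
  shows "\<gamma> j 0 = 0"
proof (cases "j = 0")
  case True
  then show ?thesis using assms by (simp add: differential_upto_def)
next
  case False
  then have "linear_on (Old j) (Old (j - 1)) (\<gamma> j)"
    using assms by (auto simp: differential_upto_def form_A_def)
  then show ?thesis unfolding P_old_eq by (rule linear_on_zero)
qed

lemma differential_upto_entries:
  assumes "differential_upto B d r i D \<rho> \<alpha> \<beta> \<gamma>" "j \<le> i"
  shows "1 \<le> j \<Longrightarrow> u \<in> Old (j - 1) \<Longrightarrow> \<rho> j u = rho_of D j u"
    and "1 \<le> j \<Longrightarrow> v \<in> Old j \<Longrightarrow> \<alpha> j v = alpha_of D j v"
    and "v \<in> Old j \<Longrightarrow> \<gamma> j v = gamma_of D j v"
proof -
  have A: "form_A B d j (D j) (\<rho> j) (\<alpha> j) (\<beta> j) (\<gamma> (j - 1)) (\<gamma> j)" "\<gamma> (j - 1) 0 = 0" if "1 \<le> j"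
    using assms differential_upto_gamma[OF assms(1), of "j - 1"] that
    by (auto simp: differential_upto_def)
  show "1 \<le> j \<Longrightarrow> u \<in> Old (j - 1) \<Longrightarrow> \<rho> j u = rho_of D j u"
    and "1 \<le> j \<Longrightarrow> v \<in> Old j \<Longrightarrow> \<alpha> j v = alpha_of D j v"
    using form_A_entries(1,2)[where D = D and j = j, OF A(1) _ A(2)] by blast+
  show "\<gamma> j v = gamma_of D j v" if "v \<in> Old j"
  proof (cases "j = 0")
    case True
    then show ?thesis
      using assms that P_closed(1)[of 0] by (auto simp: differential_upto_def gamma_of_def)
  next
    case False
    then show ?thesis using form_A_entries(3)[where D = D and j = j, OF A(1) _ A(2) that] by simp
  qed
qed

lemma differential_upto_admissible:
  assumes "differential_upto B d r i D \<rho> \<alpha> \<beta> \<gamma>"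
  shows "admissible i D"
proof -
  have "D j (incl_F j f) = incl_F (j - 1) (d j f)"
    "D j (susp u) = incl_F (j - 1) (- rho_of D j u) + susp (- gamma_of D (j - 1) u) + u"
    if "1 \<le> j" "j \<le> i" "f \<in> F j" "u \<in> Old (j - 1)" for j f u
  proof -
    have A: "form_A B d j (D j) (\<rho> j) (\<alpha> j) (\<beta> j) (\<gamma> (j - 1)) (\<gamma> j)" "\<gamma> (j - 1) 0 = 0"
      using assms differential_upto_gamma[OF assms(1), of "j - 1"] that
      by (auto simp: differential_upto_def)
    show "D j (incl_F j f) = incl_F (j - 1) (d j f)"
      using form_A_incl_F[OF A(1) that(1) A(2) that(3)] .
    show "D j (susp u) = incl_F (j - 1) (- rho_of D j u) + susp (- gamma_of D (j - 1) u) + u"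
      using form_A_susp[OF A(1) that(1) A(2) that(4)] differential_upto_entries(1)[OF assms that(2,1,4)]
        differential_upto_entries(3)[OF assms, of "j - 1" u] that by simp
  qed
  moreover have "linear_on (P j) (P (j - 1)) (D j)" if "1 \<le> j" "j \<le> i" for j
    using assms that by (auto simp: differential_upto_def form_A_def)
  ultimately show ?thesis
    using assms Old_closed(1) unfolding admissible_def differential_upto_def
    by (metis atLeastAtMost_iff free_mod_zero)
qed

lemma admissible_differential_upto:
  assumes "admissible i D" "1 \<le> i"
  shows "differential_upto B d r i D (rho_of D) (alpha_of D) (beta_of D) (gamma_of D)"
proof -
  have "D 1 (incl_F 1 f) = incl_F 0 (d 1 f)" if "f \<in> F 1" for f
    using admissible_incl_F[OF assms(1) order_refl assms(2) that] by simp
  moreover have "gamma_of D 0 u = 0" if "u \<in> Old 0" for u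
    using that admissible_0[OF assms(1) P_closed(1)] by (simp add: gamma_of_def)
  moreover have "form_A B d j (D j) (rho_of D j) (alpha_of D j) (beta_of D j)
      (gamma_of D (j - 1)) (gamma_of D j)" if "j \<in> {1..i}" for j
    using admissible_form_A[OF assms(1)] that by simp
  ultimately show ?thesis
    using assms(1) unfolding differential_upto_def admissible_def by blast
qed

lemma admissible_D:
  assumes "admissible i D" "1 \<le> j" "j \<le> i" "f \<in> F j" "u \<in> Old (j - 1)" "v \<in> Old j"
  shows "D j (incl_F j f + susp u + v) =
    incl_F (j - 1) (d j f - rho_of D j u + alpha_of D j v) +
    susp (- gamma_of D (j - 1) u + beta_of D j v) + (u + gamma_of D j v)"
  using admissible_form_A[OF assms(1-3)] assms(4-) by (simp add: form_A_def)

lemma admissible_entries_linear: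
  assumes "admissible i D" "1 \<le> j" "j \<le> i"
  shows "linear_on (Old (j - 1)) (F (j - 1)) (rho_of D j)"
    "linear_on (Old j) (F (j - 1)) (alpha_of D j)"
    "linear_on (Old j) (Old (j - 2)) (beta_of D j)"
    "linear_on (Old j) (Old (j - 1)) (gamma_of D j)"
  using admissible_form_A[OF assms] by (auto simp: form_A_def)

lemma gamma_of_linear:
  assumes "admissible i D"
  shows "linear_on (Old i) (Old (i - 1)) (gamma_of D i)"
proof (cases "i = 0")
  case True
  then show ?thesis
    using admissible_0[OF assms P_closed(1)] by (simp add: linear_on_def gamma_of_def)
qed (use admissible_entries_linear(4)[OF assms] in auto)

section \<open>Equations between the matrix entries\<close>

lemma admissible_D_zero:
  assumes "admissible i D" "1 \<le> j" "j \<le> i" "f \<in> F j" "u \<in> Old (j - 1)" "v \<in> Old j"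
    and "D j (incl_F j f + susp u + v) = 0"
  shows "d j f - rho_of D j u + alpha_of D j v = 0"
    and "- gamma_of D (j - 1) u + beta_of D j v = 0"
    and "u + gamma_of D j v = 0"
proof -
  note lin = admissible_entries_linear[OF assms(1-3)]
  have 1: "d j f - rho_of D j u + alpha_of D j v \<in> F (j - 1)"
    using linear_on_in[OF d_linear[OF assms(2)] assms(4)] linear_on_in[OF lin(1) assms(5)]
      linear_on_in[OF lin(2) assms(6)] by auto
  have 2: "u + gamma_of D j v \<in> Old (j - 1)"
    using linear_on_in[OF lin(4) assms(6)] assms(5) by (auto simp: P_old_eq)
  note 3 = proj_sums[OF 1 2, of "- gamma_of D (j - 1) u + beta_of D j v",
      folded admissible_D[OF assms(1-6)], unfolded assms(7)]
  show "d j f - rho_of D j u + alpha_of D j v = 0"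
    and "- gamma_of D (j - 1) u + beta_of D j v = 0"
    and "u + gamma_of D j v = 0"
    using 3 by simp_all
qed

text \<open>The third and the first row of \<open>D (j - 1)\<close>, applied to the components of
  \<open>D j v\<close>, give the two equations. For \<open>j = 1\<close> the first one is trivial
  because \<beta> and \<gamma> land in the zero module \<open>Old 0\<close>.\<close>

lemma admissible_square_old:
  assumes "admissible i D" "1 \<le> j" "j \<le> i" "v \<in> Old j"
  shows "beta_of D j v = - gamma_of D (j - 1) (gamma_of D j v)"
    and "2 \<le> j \<Longrightarrow> d (j - 1) (alpha_of D j v) =
      rho_of D (j - 1) (beta_of D j v) - alpha_of D (j - 1) (gamma_of D j v)"
proof -
  note lin = linear_on_in[OF admissible_entries_linear(2)[OF assms(1-3)] assms(4)]
    linear_on_in[OF admissible_entries_linear(3)[OF assms(1-3)] assms(4)]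
    linear_on_in[OF admissible_entries_linear(4)[OF assms(1-3)] assms(4)]
  have 0: "0 \<in> F j" "0 \<in> Old (j - 1)" by (auto simp: Old_closed)
  have z: "rho_of D j 0 = 0" "gamma_of D (j - 1) 0 = 0" "d j 0 = 0"
    using linear_on_zero[OF admissible_entries_linear(1)[OF assms(1-3), unfolded P_old_eq]]
      linear_on_zero[OF gamma_of_linear[OF admissible_mono[OF assms(1)], of "j - 1", unfolded P_old_eq]]
      assms(3) d_zero[OF assms(2)] by auto
  have D: "D j v = incl_F (j - 1) (alpha_of D j v) + susp (beta_of D j v) + gamma_of D j v"
    using admissible_D[OF assms(1-3) 0 assms(4)] z by simp
  have sq: "D (j - 1) (incl_F (j - 1) (alpha_of D j v) + susp (beta_of D j v) + gamma_of D j v) = 0"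
    using admissible_square[OF assms(1-3) Old_in[OF assms(4)]] D by simp
  show "beta_of D j v = - gamma_of D (j - 1) (gamma_of D j v)"
  proof (cases "j = 1")
    case True
    then show ?thesis using lin z(2) by simp
  next
    case False
    then show ?thesis
      using admissible_D_zero(3)[OF assms(1) _ _ _ _ _ sq] lin assms
      by (simp add: numeral_2_eq_2 eq_neg_iff_add_eq_0)
  qed
  assume "2 \<le> j"
  then show "d (j - 1) (alpha_of D j v) =
      rho_of D (j - 1) (beta_of D j v) - alpha_of D (j - 1) (gamma_of D j v)"
    using admissible_D_zero(1)[OF assms(1) _ _ _ _ _ sq] lin assms
    by (simp add: numeral_2_eq_2 algebra_simps)
qed

text \<open>The first row of \<open>D i\<close>, applied to the cycle
  \<open>D (Suc i) (susp u)\<close>, is the lifting equation. So a differential that has already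
  been built satisfies it, and one degree lower it helps to solve for the next \<rho>.\<close>

lemma admissible_rho_lift:
  assumes "admissible (Suc i) D" "1 \<le> i" "u \<in> Old i"
  shows "d i (rho_of D (Suc i) u) = rho_of D i (gamma_of D i u) + alpha_of D i u"
proof -
  have i: "1 \<le> Suc i" "u \<in> Old (Suc i - 1)" "i \<le> Suc i" using assms by auto
  have "D i (incl_F i (- rho_of D (Suc i) u) + susp (- gamma_of D i u) + u) = 0"
    using admissible_square[OF assms(1) i(1) order_refl susp_in[OF i(2)]]
      admissible_susp[OF assms(1) i(1) order_refl i(2)] by simp
  moreover have r: "rho_of D (Suc i) u \<in> F i"
    using linear_on_in[OF admissible_entries_linear(1)[OF assms(1) i(1) order_refl] i(2)] by simp
  moreover have g: "gamma_of D i u \<in> Old (i - 1)"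
    using linear_on_in[OF admissible_entries_linear(4)[OF assms(1,2) i(3)] assms(3)] .
  ultimately have "d i (- rho_of D (Suc i) u) - rho_of D i (- gamma_of D i u) + alpha_of D i u = 0"
    using assms by (intro admissible_D_zero(1)[OF assms(1,2) i(3)]) (auto simp: Old_closed)
  moreover have "d i (- rho_of D (Suc i) u) = - d i (rho_of D (Suc i) u)"
    using d_linear[OF assms(2)] r by (rule linear_on_uminus)
  moreover have "rho_of D i (- gamma_of D i u) = - rho_of D i (gamma_of D i u)"
    using admissible_entries_linear(1)[OF assms(1,2) i(3)] g by (rule linear_on_uminus)
  ultimately show ?thesis by (simp add: algebra_simps)
qed

text \<open>The lifting equation one degree lower, taken at \<gamma> v, turns d\<rho>\<gamma> v into
  \<rho>\<gamma>\<gamma> v + \<alpha>\<gamma> v, while the square-zero condition at v gives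
  d\<alpha> v = - \<rho>\<gamma>\<gamma> v - \<alpha>\<gamma> v. Hence \<open>?w v\<close> is a
  cycle, and exactness of \<open>F\<close> provides a preimage. For \<open>i = 1\<close> the source
  \<open>Old 1\<close> is zero.\<close>

lemma ex_rho_lift:
  assumes "admissible i D" "1 \<le> i"
  shows "\<exists>\<rho>'. rho_lift B d i (rho_of D) (alpha_of D) (gamma_of D) \<rho>'"
proof -
  note lin = admissible_entries_linear[OF assms order_refl]
  let ?w = "\<lambda>v. rho_of D i (gamma_of D i v) + alpha_of D i v"
  have w_lin: "linear_on (Old i) (F (i - 1)) ?w"
    by (intro linear_on_plus linear_on_comp[OF lin(4) lin(1)] lin(2))
  have "?w v \<in> d i ` F i" if v: "v \<in> Old i" for v
  proof (cases "i = 1")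
    case True
    then have "v = 0" using v Old_1 by auto
    then have "?w v = 0" using linear_on_zero[OF w_lin[unfolded P_old_eq]] by simp
    then show ?thesis using d_zero[OF assms(2)] by (metis free_mod_zero imageI)
  next
    case False
    then have i2: "1 \<le> i - 1" "2 \<le> i" "i - 1 \<le> i" using assms(2) by auto
    have g: "gamma_of D i v \<in> Old (i - 1)" using linear_on_in[OF lin(4) v] .
    have gg: "gamma_of D (i - 1) (gamma_of D i v) \<in> Old (i - 1 - 1)"
      using linear_on_in[OF admissible_entries_linear(4)[OF assms(1) i2(1,3)] g] .
    have r: "rho_of D i (gamma_of D i v) \<in> F (i - 1)" using linear_on_in[OF lin(1) g] .
    have a: "alpha_of D i v \<in> F (i - 1)" using linear_on_in[OF lin(2) v] .
    have "d (i - 1) (rho_of D i (gamma_of D i v)) =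
        rho_of D (i - 1) (gamma_of D (i - 1) (gamma_of D i v)) + alpha_of D (i - 1) (gamma_of D i v)"
      using admissible_rho_lift[of "i - 1" D "gamma_of D i v"] assms(1) i2 g by simp
    moreover have "d (i - 1) (alpha_of D i v) = - rho_of D (i - 1) (gamma_of D (i - 1) (gamma_of D i v))
        - alpha_of D (i - 1) (gamma_of D i v)"
      using admissible_square_old[OF assms order_refl v] i2(2)
        linear_on_uminus[OF admissible_entries_linear(1)[OF assms(1) i2(1,3)] gg] by simp
    ultimately have "d (i - 1) (?w v) = 0"
      using linear_on_add[OF d_linear[OF i2(1)] r a] by simp
    then show ?thesis
      using d_exact[OF i2(1)] linear_on_in[OF w_lin v] i2 by auto
  qed
  \<comment> \<open>Preimages are chosen on the monomial basis and extended linearly, since a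
    separate choice for every element need not be linear.\<close>
  then have "\<forall>m\<in>old_mons B i. \<exists>f. f \<in> F i \<and> d i f = ?w (mon m)"
    by (metis (no_types, lifting) P_old_eq free_mod_single imageE)
  then obtain h where h: "\<And>m. m \<in> old_mons B i \<Longrightarrow> h m \<in> F i \<and> d i (h m) = ?w (mon m)"
    by metis
  have l: "linear_on (Old i) (F i) (lin_ext h)"
    unfolding P_old_eq using h by (intro linear_on_lin_ext) auto
  moreover have "d i (lin_ext h u) = ?w u" if "u \<in> Old i" for u
    using linear_on_comp[OF l d_linear[OF assms(2)]] w_lin _ that unfolding P_old_eq
    by (rule linear_on_eqI) (use h in simp)
  ultimately show ?thesis by (auto simp: rho_lift_def)
qed

section \<open>Construction and uniqueness of the next map\<close>

lemma next_differential_admissible: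
  assumes "admissible i D" "next_differential B d r i D (gamma_of D) \<rho>' D'"
  shows "admissible (Suc i) (D(Suc i := D'))"
proof -
  let ?E = "D(Suc i := D')"
  obtain \<alpha>' \<beta>' \<gamma>' where A: "form_A B d (Suc i) (?E (Suc i)) \<rho>' \<alpha>' \<beta>' (gamma_of D i) \<gamma>'"
    and leib: "leibniz_at P (\<star>) ?E (Suc i)" and sq: "square_zero_at B ?E (Suc i)"
    using assms(2) by (auto simp: next_differential_def)
  have g0: "gamma_of D i 0 = 0"
    using linear_on_zero[OF gamma_of_linear[OF assms(1), unfolded P_old_eq]] .
  have "admissible i ?E" using assms(1) by (subst admissible_cong[where E = D]) auto
  moreover have "linear_on (P (Suc i)) (P i) D'" using A by (simp add: form_A_def)
  moreover have "D' (incl_F (Suc i) f) = incl_F i (d (Suc i) f)" if "f \<in> F (Suc i)" for f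
    using form_A_incl_F[OF A _ g0 that] by simp
  moreover have "D' (susp u) = incl_F i (- rho_of ?E (Suc i) u) + susp (- gamma_of ?E i u) + u"
    if "u \<in> Old i" for u
    using form_A_susp[OF A _ g0, of u] form_A_entries(1)[where D = ?E and j = "Suc i", OF A _ g0, of u] that
    by (simp add: gamma_of_def)
  ultimately show ?thesis
    using leib sq unfolding admissible_def atLeastAtMostSuc_conv[of 1 i, simplified] by simp
qed

text \<open>A derivation of the whole algebra needs values on all generators: up to degree
  \<open>i\<close> they copy \<open>D\<close>, in degree \<open>Suc i\<close> form (A) dictates
  them, and in higher degrees zero is a placeholder that the derivation again sends to zero.\<close>

definition next_on_gens :: "nat \<Rightarrow> (nat \<Rightarrow> ('b, 'r) alg \<Rightarrow> ('b, 'r) alg) \<Rightarrow>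
    (('b, 'r) alg \<Rightarrow> ('b \<Rightarrow>\<^sub>0 'r)) \<Rightarrow> 'b gen \<Rightarrow> ('b, 'r) alg" where
  "next_on_gens i D \<rho>' g =
     (if gdeg g \<le> i then D (gdeg g) (mon {#g#})
      else if gdeg g = Suc i then
        (case g of
           Base j e \<Rightarrow> incl_F i (d (Suc i) (single e 1))
         | Susp m \<Rightarrow> incl_F i (- \<rho>' (mon m)) + susp (- gamma_of D i (mon m)) + mon m)
      else 0)"

lemma gen_cases:
  assumes "g \<in> all_gens B"
  obtains (base) e where "g = Base (gdeg g) e" "e \<in> B (gdeg g)" "1 \<le> gdeg g"
  | (susp) m where "g = Susp m" "m \<in> old_mons B (gdeg g - 1)" "1 \<le> gdeg g"
  using assms by (cases g) (auto simp: all_gens_iff)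

text \<open>For existence the derivation generated by \<open>next_on_gens\<close> is restricted to
  \<open>P (Suc i)\<close>; uniqueness holds because form (A) fixes the values on generators. Values
  outside \<open>P (Suc i)\<close> are arbitrary, hence the extensional function space. The case
  \<open>i = 0\<close> is included, without a lifting condition, so that the first differential
  comes from the same construction.\<close>

lemma ex1_next_differential:
  assumes adm: "admissible i D" and \<rho>': "linear_on (Old i) (F i) \<rho>'"
    and lift: "1 \<le> i \<Longrightarrow> rho_lift B d i (rho_of D) (alpha_of D) (gamma_of D) \<rho>'"
  shows "\<exists>!D'. D' \<in> P (Suc i) \<rightarrow>\<^sub>E P i \<and> next_differential B d r i D (gamma_of D) \<rho>' D'"
proof -
  note \<gamma> = gamma_of_linear[OF adm]
  have \<gamma>0: "gamma_of D i 0 = 0" using linear_on_zero[OF \<gamma>[unfolded P_old_eq]] .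
  define dg where "dg = next_on_gens i D \<rho>'"
  \<comment> \<open>The middle column of form (A): the value prescribed on
    \<open>susp u\<close>.\<close>
  define S where "S u = incl_F i (- \<rho>' u) + susp (- gamma_of D i u) + u" for u
  have S_lin: "linear_on (Old i) (P i) S"
  proof -
    have "linear_on (Old i) (P i) (\<lambda>u. incl_F i (- \<rho>' u))"
      using linear_on_comp[OF linear_on_neg[OF \<rho>'] linear_incl_F] .
    moreover have "linear_on (Old i) (P i) (\<lambda>u. susp (- gamma_of D i u))"
      using linear_on_comp[OF linear_on_neg[OF \<gamma>[unfolded P_old_eq], folded P_old_eq] linear_on_susp] .
    moreover have "linear_on (Old i) (P i) (\<lambda>u. u)"
      using Old_in by (simp add: linear_on_def)
    ultimately show ?thesis
      unfolding S_def P_part_free by (intro linear_on_plus)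
  qed
  have mon_old: "mon m \<in> Old i" if "m \<in> old_mons B i" for m
    using that by (auto simp: P_old_eq)
  have dg_base: "dg (Base (Suc i) e) = incl_F i (d (Suc i) (single e 1))" for e
    by (simp add: dg_def next_on_gens_def)
  have dg_susp: "dg (Susp m) = S (mon m)" if "m \<in> old_mons B i" for m
    using old_mons_mdeg[OF that] by (simp add: dg_def next_on_gens_def S_def)
  have dg_low: "dg g = D (gdeg g) (mon {#g#})" if "gdeg g \<le> i" for g
    using that by (simp add: dg_def next_on_gens_def)
  have dg_high: "dg g = 0" if "Suc i < gdeg g" for g
    using that by (simp add: dg_def next_on_gens_def)
  have mon_gen: "mon {#g#} \<in> P (gdeg g)" if "g \<in> all_gens B" for g
    using that by (auto simp: P_part_free)
  have d_Base: "d (Suc i) (single e 1) \<in> F i" if "e \<in> B (Suc i)" for e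
    using linear_on_in[OF d_linear[of "Suc i"]] that by (simp add: free_mod_single)
  interpret Der: generator_map gdeg r "all_gens B" dg
  proof
    fix g assume g: "g \<in> all_gens B"
    then show "0 < gdeg g" by (rule all_gens_gdeg)
    consider "gdeg g \<le> i" | "gdeg g = Suc i" | "Suc i < gdeg g" by linarith
    then have "dg g \<in> P (gdeg g - 1)"
    proof cases
      case 1
      with dg_low show ?thesis
        using linear_on_in[OF admissible_linear[OF adm _ 1] mon_gen[OF g]] all_gens_gdeg(1)[OF g] by simp
    next
      case 2
      from g show ?thesis
        by (cases rule: gen_cases)
           (use 2 dg_base dg_susp d_Base incl_F_in mon_old linear_on_in[OF S_lin] in \<open>auto\<close>)
    next
      case 3
      then show ?thesis by (simp add: dg_high P_closed)
    qed
    then show "dg g \<in> sym_part gdeg (all_gens B) (gdeg g - 1)" by (simp add: P_part_eq)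
  qed
  have Der_linear: "linear_on (P n) (P (n - 1)) Der.Der" for n
    using Der.linear_on_Der by (simp add: P_part_eq)
  \<comment> \<open>The given maps are restrictions of the new derivation, so what is known about
    \<open>D\<close> up to degree \<open>i\<close> carries over to it.\<close>
  have Der_low: "D n x = Der.Der x" if "x \<in> P n" "n \<le> i" for n x
    using admissible_linear[OF adm] admissible_leibniz[OF adm] admissible_0[OF adm] dg_low that
    unfolding P_part_eq by (intro Der.Leibniz_unique[of i D x n]) auto
  have Der_incl: "Der.Der (incl_F (Suc i) f) = incl_F i (d (Suc i) f)" if "f \<in> F (Suc i)" for f
  proof (rule linear_on_eqI[OF _ _ _ that])
    show "linear_on (F (Suc i)) (P i) (\<lambda>f. Der.Der (incl_F (Suc i) f))"
      using linear_on_comp[OF linear_incl_F Der_linear[of "Suc i"]] by simp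
    show "linear_on (F (Suc i)) (P i) (\<lambda>f. incl_F i (d (Suc i) f))"
      using linear_on_comp[OF _ linear_incl_F] d_linear[of "Suc i"] by simp
    show "Der.Der (incl_F (Suc i) (single e 1)) = incl_F i (d (Suc i) (single e 1))"
      if "e \<in> B (Suc i)" for e
      using that Der.Der_gen[of "Base (Suc i) e"] by (simp add: incl_F_lin_ext all_gens_iff dg_base[unfolded incl_F_lin_ext])
  qed
  have Der_susp: "Der.Der (susp u) = S u" if "u \<in> Old i" for u
  proof (rule linear_on_eqI[OF _ _ _ that[unfolded P_old_eq]])
    show "linear_on (free_mod (old_mons B i)) (P i) (\<lambda>u. Der.Der (susp u))"
      using linear_on_comp[OF linear_on_susp[of B "Suc i"] Der_linear[of "Suc i"]] by (simp add: P_old_eq)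
    show "linear_on (free_mod (old_mons B i)) (P i) S"
      using S_lin by (simp add: P_old_eq)
    show "Der.Der (susp (mon m)) = S (mon m)" if "m \<in> old_mons B i" for m
      using that Der.Der_gen[of "Susp m"] by (simp add: susp_lin_ext all_gens_iff old_mons_mdeg dg_susp)
  qed
  \<comment> \<open>In form (A) for \<open>D i\<close>, the first row vanishes by the lifting
    equation, the second by \<open>admissible_square_old\<close>, and the third cancels
    directly.\<close>
  have S_cycle: "Der.Der (S u) = 0" if u: "u \<in> Old i" for u
  proof (cases "i = 0")
    case True
    then show ?thesis
      using linear_on_in[OF S_lin u] Der.Der_degree_0 by (simp add: P_part_eq)
  next
    case False
    then have i: "1 \<le> i" by simp
    have r: "\<rho>' u \<in> F i" using linear_on_in[OF \<rho>' u] .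
    have g: "gamma_of D i u \<in> Old (i - 1)" using linear_on_in[OF \<gamma> u] .
    have "Der.Der (S u) = D i (S u)" using Der_low linear_on_in[OF S_lin u] by simp
    also have "\<dots> = incl_F (i - 1) (d i (- \<rho>' u) - rho_of D i (- gamma_of D i u) + alpha_of D i u) +
        susp (- gamma_of D (i - 1) (- gamma_of D i u) + beta_of D i u) + (- gamma_of D i u + gamma_of D i u)"
      unfolding S_def using r g u by (intro admissible_D[OF adm i order_refl]) (auto simp: Old_closed)
    also have "d i (- \<rho>' u) = - d i (\<rho>' u)"
      using d_linear[OF i] r by (rule linear_on_uminus)
    also have "rho_of D i (- gamma_of D i u) = - rho_of D i (gamma_of D i u)"
      using admissible_entries_linear(1)[OF adm i order_refl] g by (rule linear_on_uminus)
    also have "gamma_of D (i - 1) (- gamma_of D i u) = - gamma_of D (i - 1) (gamma_of D i u)"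
      using gamma_of_linear[OF admissible_mono[OF adm, of "i - 1"]] g by (intro linear_on_uminus) auto
    also have "d i (\<rho>' u) = rho_of D i (gamma_of D i u) + alpha_of D i u"
      using lift[OF i] u by (simp add: rho_lift_def)
    also have "beta_of D i u = - gamma_of D (i - 1) (gamma_of D i u)"
      using admissible_square_old(1)[OF adm i order_refl u] .
    finally show ?thesis by simp
  qed
  have Der_dg: "Der.Der (dg g) = 0" if g: "g \<in> all_gens B" for g
  proof -
    consider "gdeg g \<le> i" | "gdeg g = Suc i" | "Suc i < gdeg g" by linarith
    then show ?thesis
    proof cases
      case 1
      have "1 \<le> gdeg g" using all_gens_gdeg(1)[OF g] by simp
      note * = admissible_square[OF adm this 1 mon_gen[OF g]]
        linear_on_in[OF admissible_linear[OF adm this 1] mon_gen[OF g]]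
      then show ?thesis using Der_low[OF *(2)] 1 by (simp add: dg_low)
    next
      case 2
      from g show ?thesis
      proof (cases rule: gen_cases)
        case (base e)
        let ?h = "d (Suc i) (single e 1)"
        have h: "?h \<in> F i" using base 2 d_Base by simp
        have "Der.Der (incl_F i ?h) = 0"
        proof (cases "i = 0")
          case True
          then show ?thesis using incl_F_in[OF h] Der.Der_degree_0 by (simp add: P_part_eq)
        next
          case False
          then have "d i ?h = 0"
            using d_exact[of i] base 2 by (auto simp: free_mod_single)
          then show ?thesis
            using False Der_low[OF incl_F_in[OF h]] admissible_incl_F[OF adm _ _ h] by simp
        qed
        then show ?thesis using base 2 dg_base by metis
      next
        case (susp m)
        then show ?thesis using 2 S_cycle mon_old dg_susp by simp
      qed
    next
      case 3
      then show ?thesis by (simp add: dg_high)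
    qed
  qed
  have Der_square: "Der.Der (Der.Der x) = 0" if "x \<in> P n" for x n
    using Der.Der_square_zero[OF Der_dg] that by (simp add: P_part_eq)
  define D' where "D' = restrict Der.Der (P (Suc i))"
  have D'_ext: "D' \<in> P (Suc i) \<rightarrow>\<^sub>E P i"
    using linear_on_in[OF Der_linear[of "Suc i"]] by (auto simp: D'_def)
  have D'_eq: "D' x = Der.Der x" if "x \<in> P (Suc i)" for x
    using that by (simp add: D'_def)
  have E_eq: "(D(Suc i := D')) n x = Der.Der x" if "x \<in> P n" "n \<le> Suc i" for n x
    using that D'_eq Der_low by (cases "n = Suc i") auto
  have "form_A B d (Suc i) D' \<rho>' (\<lambda>v. proj_F e0 (Suc i - 1) (D' v)) (\<lambda>v. proj_susp (D' v)) (gamma_of D i)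
    (\<lambda>v. proj_old B (Suc i - 1) (D' v))"
  proof (rule form_A_of_proj)
    show "linear_on (P (Suc i)) (P (Suc i - 1)) D'"
      using Der_linear[of "Suc i"] D'_eq P_closed(2)[of _ "Suc i"]
      unfolding linear_on_def by (simp add: P_part_free free_mod_scale)
    show "D' (incl_F (Suc i) f) = incl_F (Suc i - 1) (d (Suc i) f)" if "f \<in> F (Suc i)" for f
      using that D'_eq Der_incl incl_F_in by simp
    show "D' (susp u) = incl_F (Suc i - 1) (- \<rho>' u) + susp (- gamma_of D i u) + u"
      if "u \<in> Old (Suc i - 1)" for u
      using that D'_eq Der_susp susp_in[OF that] by (simp add: S_def)
  qed (use \<rho>' in auto)
  moreover have "leibniz_at P (\<star>) (D(Suc i := D')) (Suc i)"
    using Der.leibniz_at_Der[of "Suc i"] E_eq order unfolding P_part_eq[symmetric]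
    by (subst leibniz_at_mono_cong[where E = "\<lambda>_. Der.Der"]) auto
  moreover have "square_zero_at B (D(Suc i := D')) (Suc i)"
    unfolding square_zero_at_def
    using D'_eq Der_low[OF linear_on_in[OF Der_linear[of "Suc i"]], simplified] Der_square by simp
  ultimately have next_D': "next_differential B d r i D (gamma_of D) \<rho>' D'"
    unfolding next_differential_def by blast
  have "D'' = D'" if D'': "D'' \<in> P (Suc i) \<rightarrow>\<^sub>E P i" "next_differential B d r i D (gamma_of D) \<rho>' D''" for D''
  proof -
    let ?E = "D(Suc i := D'')"
    note adm' = next_differential_admissible[OF adm D''(2)]
    obtain \<alpha>' \<beta>' \<gamma>' where A: "form_A B d (Suc i) D'' \<rho>' \<alpha>' \<beta>' (gamma_of D i) \<gamma>'"
      using D''(2) by (auto simp: next_differential_def)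
    \<comment> \<open>Generators of degree \<open>Suc i\<close> are images of basis elements under
      \<open>incl_F\<close> or \<open>susp\<close>, where form (A) leaves no choice.\<close>
    have gen: "?E (gdeg g) (mon {#g#}) = dg g" if g: "g \<in> all_gens B" "gdeg g \<le> Suc i" for g
    proof (cases "gdeg g = Suc i")
      case True
      from g(1) show ?thesis
      proof (cases rule: gen_cases)
        case (base e)
        have "D'' (incl_F (Suc i) (single e 1)) = incl_F i (d (Suc i) (single e 1))"
          using form_A_incl_F[OF A _ \<gamma>0] base True by (simp add: free_mod_single)
        moreover have "incl_F (Suc i) (single e (1 :: 'r)) = mon {#g#}"
          using base True by (simp add: incl_F_lin_ext)
        moreover have "dg g = incl_F i (d (Suc i) (single e 1))"
          using base True dg_base by metis
        ultimately show ?thesis using True by simp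
      next
        case (susp m)
        then have "D'' (susp (mon m)) = S (mon m)"
          using form_A_susp[OF A _ \<gamma>0, of "mon m"] True mon_old by (simp add: S_def)
        then show ?thesis using susp True dg_susp by (simp add: susp_lin_ext)
      qed
    qed (use g dg_low in auto)
    have "?E (Suc i) x = Der.Der x" if "x \<in> P (Suc i)" for x
      using admissible_linear[OF adm'] admissible_leibniz[OF adm'] admissible_0[OF adm'] gen that
      unfolding P_part_eq by (intro Der.Leibniz_unique[of "Suc i" ?E x "Suc i"]) auto
    then have "D'' x = D' x" if "x \<in> P (Suc i)" for x using that D'_eq by simp
    then show ?thesis using D''(1) D'_ext by (rule_tac PiE_ext)
  qed
  then show ?thesis using D'_ext next_D' by blast
qed

section \<open>Continuing the induction through all degrees\<close>

lemma ex_next_admissible: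
  assumes "admissible i D"
  shows "\<exists>D'. admissible (Suc i) (D(Suc i := D'))"
proof -
  obtain \<rho>' where "linear_on (Old i) (F i) \<rho>'"
    "1 \<le> i \<Longrightarrow> rho_lift B d i (rho_of D) (alpha_of D) (gamma_of D) \<rho>'"
  proof (cases "i = 0")
    case True
    then show ?thesis using that[of "\<lambda>_. 0"] by (auto simp: linear_on_def)
  next
    case False
    then show ?thesis using that ex_rho_lift[OF assms] by (auto simp: rho_lift_def)
  qed
  from ex1_implies_ex[OF ex1_next_differential[OF assms this]]
  show ?thesis using next_differential_admissible[OF assms] by blast
qed

text \<open>Dependent choice yields stages \<open>S n\<close> in which the maps of degree up to
  \<open>i + n\<close> no longer change. The diagonal \<open>E j = S j j\<close> picks the stable
  value, because \<open>j \<le> i + j\<close>.\<close>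

lemma ex_admissible_extension:
  assumes "admissible i D"
  obtains E where "\<And>n. admissible n E" "\<And>j. j \<le> i \<Longrightarrow> E j = D j"
proof -
  have "\<exists>S. \<forall>n. (admissible (i + n) (S n) \<and> (n = 0 \<longrightarrow> S n = D)) \<and> (\<forall>j\<le>i + n. S (Suc n) j = S n j)"
  proof (rule dependent_nat_choice)
    show "\<exists>x. admissible (i + 0) x \<and> (0 = (0::nat) \<longrightarrow> x = D)" using assms by auto
    fix x n assume "admissible (i + n) x \<and> (n = 0 \<longrightarrow> x = D)"
    then obtain D' where "admissible (Suc (i + n)) (x(Suc (i + n) := D'))"
      using ex_next_admissible by blast
    then show "\<exists>y. (admissible (i + Suc n) y \<and> (Suc n = 0 \<longrightarrow> y = D)) \<and> (\<forall>j\<le>i + n. y j = x j)"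
      by (intro exI[of _ "x(Suc (i + n) := D')"]) auto
  qed
  then obtain S where S: "\<And>n. admissible (i + n) (S n)" "S 0 = D"
    "\<And>n j. j \<le> i + n \<Longrightarrow> S (Suc n) j = S n j"
    by blast
  have stable: "S (n + k) j = S n j" if "j \<le> i + n" for n k j
    using that by (induction k) (auto simp: S(3))
  define E where "E j = S j j" for j
  have "admissible n E" for n
    using admissible_mono[OF S(1)[of n], of n] stable[of _ _ "n - _"]
    by (subst admissible_cong[where E = "S n"]) (auto simp: E_def, metis le_add_diff_inverse le_add2 stable)
  moreover have "E j = D j" if "j \<le> i" for j
    using stable[of j 0 j] that S(2) by (simp add: E_def)
  ultimately show ?thesis using that by blast
qed

lemma admissible_inductive:
  assumes "\<And>n. admissible n D"
  shows "inductive_differential B d r D"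
  unfolding inductive_differential_def rho_lift_def
  using admissible_differential_upto[OF assms] admissible_rho_lift[OF assms]
    admissible_entries_linear(1)[OF assms, of "Suc _"]
  by (metis diff_Suc_1 le_add1 order_refl plus_1_eq_Suc)

lemma inductive_admissible:
  assumes "inductive_differential B d r D"
  shows "admissible n D"
proof -
  have "admissible (Suc n) D"
    using assms differential_upto_admissible unfolding inductive_differential_def
    by (metis le_add1 plus_1_eq_Suc)
  then show ?thesis by (rule admissible_mono) simp
qed

lemma ex_admissible_1: "\<exists>D. admissible 1 D"
proof -
  have "admissible 0 (\<lambda>_ _. 0)" by (simp add: admissible_def)
  then show ?thesis using ex_next_admissible by fastforce
qed

end

section \<open>Homology\<close>

text \<open>When two elements are related exactly if \<open>f\<close> agrees on them, the image of a
  class is the singleton of the common value. The homology of \<open>conc\<close> consists of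
  singletons too, so taking images under the augmentation is itself the map on homology.\<close>

lemma bij_betw_image_quotient:
  assumes R: "R = {(x, y). x \<in> X \<and> y \<in> X \<and> f x = f y}"
  shows "bij_betw (image f) (X // R) ((\<lambda>y. {y}) ` f ` X)"
    and "x \<in> X \<Longrightarrow> f ` (R `` {x}) = {f x}"
proof -
  have im: "f ` (R `` {x}) = {f x}" if "x \<in> X" for x
    using that by (auto simp: R)
  then show "x \<in> X \<Longrightarrow> f ` (R `` {x}) = {f x}" .
  have "inj_on (image f) (X // R)"
  proof (rule inj_onI)
    fix C C' assume "C \<in> X // R" "C' \<in> X // R" and eq: "f ` C = f ` C'"
    then obtain x y where xy: "x \<in> X" "C = R `` {x}" "y \<in> X" "C' = R `` {y}"
      by (auto elim!: quotientE)
    with eq im have "f x = f y" by auto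
    with xy show "C = C'" by (auto simp: R)
  qed
  moreover have "X // R = (\<lambda>x. R `` {x}) ` X"
    by (auto simp: quotient_def)
  then have "image f ` (X // R) = (\<lambda>y. {y}) ` f ` X"
    unfolding image_image using im by (simp add: image_image cong: image_cong)
  ultimately show "bij_betw (image f) (X // R) ((\<lambda>y. {y}) ` f ` X)"
    by (simp add: bij_betw_def)
qed

lemma homology_conc:
  "cycles conc (\<lambda>_ _. 0) n = (conc n :: 's::comm_ring set)"
  "homologous conc (\<lambda>_ _. 0) n = {(x, y). x \<in> conc n \<and> x = (y :: 's)}"
  "homology conc (\<lambda>_ _. 0) n = (\<lambda>y. {y}) ` (conc n :: 's set)"
proof -
  show 1: "cycles conc (\<lambda>_ _. 0) n = (conc n :: 's set)"
    by (simp add: cycles_def)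
  have "0 \<in> (conc (Suc n) :: 's set)" by (simp add: conc_def)
  then show 2: "homologous conc (\<lambda>_ _. 0) n = {(x, y). x \<in> conc n \<and> x = (y :: 's)}"
    by (auto simp: homologous_def 1)
  show "homology conc (\<lambda>_ _. 0) n = (\<lambda>y. {y}) ` (conc n :: 's set)"
    by (auto simp: homology_def 1 2 quotient_def)
qed

context free_res
begin

section \<open>Exactness of the constructed complex\<close>

lemma admissible_exact:
  assumes adm: "\<And>n. admissible n D" and n: "1 \<le> n" and x: "x \<in> P n" "D n x = 0"
  shows "x \<in> D (Suc n) ` P (Suc n)"
proof -
  define f u v where "f = proj_F e0 n x" and "u = proj_susp x" and "v = proj_old B n x"
  have in_summands: "f \<in> F n" "u \<in> Old (n - 1)" "v \<in> Old n"
    unfolding f_def u_def v_def using linear_on_in[OF linear_proj(1) x(1)]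
      linear_on_in[OF linear_proj(2) x(1)] linear_on_in[OF linear_proj(3) x(1)] by auto
  have x_eq: "x = incl_F n f + susp u + v"
    unfolding f_def u_def v_def using decomposition[OF x(1)] by simp
  \<comment> \<open>The identity block in the third row forces this; hence
    \<open>D (Suc n) (susp v)\<close> has the same last two components as \<open>x\<close>.\<close>
  have u: "u = - gamma_of D n v"
    using admissible_D_zero(3)[OF adm n order_refl in_summands] x(2)
    by (simp add: x_eq eq_neg_iff_add_eq_0)
  have sv: "susp v \<in> P (Suc n)" using susp_in[of v "Suc n"] in_summands by simp
  have r: "rho_of D (Suc n) v \<in> F n"
    using linear_on_in[OF admissible_entries_linear(1)[OF adm[of "Suc n"], of "Suc n"], of v]
      in_summands by simp
  let ?f = "f + rho_of D (Suc n) v"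
  have f: "?f \<in> F n" using in_summands r by auto
  have "D (Suc n) (susp v) = incl_F n (- rho_of D (Suc n) v) + susp u + v"
    using admissible_susp[OF adm[of "Suc n"], of "Suc n" v] in_summands u by simp
  then have x_eq': "x = incl_F n ?f + D (Suc n) (susp v)"
    by (simp add: x_eq incl_F_add incl_F_uminus)
  have "D n (D (Suc n) (susp v)) = 0"
    using admissible_square[OF adm[of "Suc n"] _ order_refl sv] by simp
  moreover have "D (Suc n) (susp v) \<in> P n"
    using linear_on_in[OF admissible_linear[OF adm[of "Suc n"] _ order_refl] sv] by simp
  ultimately have "D n (incl_F n ?f) = 0"
    using x(2) linear_on_add[OF admissible_linear[OF adm n order_refl] incl_F_in[OF f]]
    unfolding x_eq' by simp
  then have "incl_F (n - 1) (d n ?f) = 0"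
    using admissible_incl_F[OF adm n order_refl f] by simp
  \<comment> \<open>\<open>incl_F\<close> is injective, with \<open>proj_F\<close> as left
    inverse.\<close>
  then have "d n ?f = 0"
    using proj_F_incl_F[OF linear_on_in[OF d_linear[OF n] f]] by (metis proj_zero(1))
  then obtain h where h: "h \<in> F (Suc n)" "?f = d (Suc n) h"
    using d_exact[OF n] f by auto
  have "D (Suc n) (incl_F (Suc n) h) = incl_F n ?f"
    using admissible_incl_F[OF adm[of "Suc n"] _ order_refl h(1)] h(2) by simp
  then have "D (Suc n) (incl_F (Suc n) h + susp v) = x"
    using linear_on_add[OF admissible_linear[OF adm[of "Suc n"] _ order_refl] incl_F_in[OF h(1)] sv]
      x_eq' by simp
  then show ?thesis
    using P_closed(2)[OF incl_F_in[OF h(1)] sv] by blast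
qed

lemma F0_eq: "h \<in> F 0 \<Longrightarrow> incl_F 0 h = sym_scalar (lookup h e0)"
  unfolding B0
  by (induction rule: free_mod_induct)
     (auto simp: incl_F_lin_ext lin_ext_add sym_scalar_def lookup_add lookup_single single_add)

text \<open>Since \<open>Old 0\<close> and \<open>Old 1\<close> vanish, \<open>P 1\<close> is a copy
  of \<open>F 1\<close>. The boundaries in degree 0 are therefore the image of \<open>d 1\<close>,
  which the resolution identifies with the kernel of \<open>\<pi>\<close>.\<close>

lemma admissible_exact_0:
  assumes adm: "\<And>n. admissible n D" and x: "x \<in> P 0"
  shows "\<pi> (lookup x {#}) = 0 \<longleftrightarrow> x \<in> D 1 ` P 1"
proof -
  obtain c where c: "x = sym_scalar c" using x P_part_0 by blast
  have P1: "P 1 = incl_F 1 ` F 1"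
  proof
    show "P 1 \<subseteq> incl_F 1 ` F 1"
    proof
      fix y assume y: "y \<in> P 1"
      have "proj_susp y = 0" "proj_old B 1 y = 0"
        using linear_on_in[OF linear_proj(2) y] linear_on_in[OF linear_proj(3) y] Old_1 by auto
      then have "y = incl_F 1 (proj_F e0 1 y)" using decomposition[OF y] by simp
      then show "y \<in> incl_F 1 ` F 1" using linear_on_in[OF linear_proj(1) y] by blast
    qed
  qed (use incl_F_in in blast)
  have D1: "D 1 (incl_F 1 f) = sym_scalar (lookup (d 1 f) e0)" if "f \<in> F 1" for f
    using admissible_incl_F[OF adm[of 1] _ _ that] F0_eq linear_on_in[OF d_linear[of 1] that] by simp
  have "\<pi> c = 0 \<longleftrightarrow> single e0 c \<in> {x \<in> F 0. \<pi> (lookup x e0) = 0}"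
    by (auto simp: B0)
  also have "\<dots> \<longleftrightarrow> (\<exists>f\<in>F 1. c = lookup (d 1 f) e0)"
  proof -
    have "single e0 c = d 1 f \<longleftrightarrow> c = lookup (d 1 f) e0" if "f \<in> F 1" for f
    proof -
      have "d 1 f \<in> free_mod {e0}" using linear_on_in[OF d_linear[of 1] that] B0 by simp
      then show ?thesis
        by (metis lookup_single_eq poly_mapping_eqI lookup_single_not_eq free_mod_iff singletonD)
    qed
    then show ?thesis unfolding d_exact_0 by blast
  qed
  also have "\<dots> \<longleftrightarrow> sym_scalar c \<in> D 1 ` P 1"
  proof -
    have "sym_scalar a = (sym_scalar b :: ('b, 'r) alg) \<longleftrightarrow> a = b" for a b
      unfolding sym_scalar_def by (metis lookup_single_eq)
    then show ?thesis unfolding P1 image_image using D1 by (auto simp: image_iff)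
  qed
  finally show ?thesis by (simp add: c sym_scalar_def)
qed

lemma cdga_admissible:
  assumes adm: "\<And>n. admissible n D"
  shows "cdga P (\<star>) (sym_scalar 1) D"
proof -
  have "leibniz_at P (\<star>) D n" for n
  proof (cases "n = 0")
    case True
    have "y \<star> z \<in> P 0" if "y \<in> P 0" "z \<in> P 0" for y z
      using mul_in[of y _ 0 z 0] that by (simp add: P_part_eq)
    then show ?thesis
      using True admissible_0[OF adm] by (simp add: leibniz_at_def)
  qed (use admissible_leibniz[OF adm[of n], of n] in auto)
  moreover have "linear_on (P (Suc n)) (P n) (D (Suc n))" for n
    using admissible_linear[OF adm[of "Suc n"], of "Suc n"] by simp
  moreover have "D n (D (Suc n) x) = 0" if "x \<in> P (Suc n)" for n x
    using admissible_square[OF adm[of "Suc n"] _ order_refl that] by simp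
  moreover have "graded_comm_algebra P (\<star>) (sym_scalar 1)"
    unfolding P_part_eq[THEN ext] by (rule graded_comm_algebra_sym_part)
  ultimately show ?thesis
    using admissible_0[OF adm] by (simp add: cdga_def)
qed

end

section \<open>The augmentation as a quasi-isomorphism\<close>

locale quotient_res = free_res r B e0 d \<pi>
  for r :: "'b gen rel" and B :: "nat \<Rightarrow> 'b set" and e0 :: 'b
    and d :: "nat \<Rightarrow> ('b \<Rightarrow>\<^sub>0 'r::comm_ring_1) \<Rightarrow> ('b \<Rightarrow>\<^sub>0 'r)"
    and \<pi> :: "'r \<Rightarrow> 's::comm_ring" +
  fixes D :: "nat \<Rightarrow> ('b, 'r) alg \<Rightarrow> ('b, 'r) alg"
  assumes quotient: "quotient_map \<pi>" and inductive_D: "inductive_differential B d r D"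
begin

lemmas adm = inductive_admissible[OF inductive_D]

lemma pi_add: "\<pi> (a + b) = \<pi> a + \<pi> b" and pi_mult: "\<pi> (a * b) = \<pi> a * \<pi> b" and pi_surj: "surj \<pi>"
  using quotient by (auto simp: quotient_map_def)

lemma pi_diff: "\<pi> (a - b) = \<pi> a - \<pi> b"
  using pi_add[of "a - b" b] by (simp add: algebra_simps)

abbreviation \<epsilon> :: "nat \<Rightarrow> ('b, 'r) alg \<Rightarrow> 's" where "\<epsilon> \<equiv> augmentation \<pi>"

lemma cycles_0: "cycles P D 0 = P 0"
  using admissible_0[OF adm] by (auto simp: cycles_def)

lemma D_zero: "D n 0 = 0"
proof (cases "n = 0")
  case False
  then show ?thesis
    using linear_on_zero[OF admissible_linear[OF adm, of n n, unfolded P_part_free]] by simp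
qed (use admissible_0[OF adm] P_closed(1) in auto)

text \<open>In degree 0 the boundaries are the kernel of the augmentation; in positive degrees every
  cycle bounds and the augmentation is constantly zero. This brings the relation into the form
  required by \<open>bij_betw_image_quotient\<close> in all degrees at once.\<close>

lemma homologous_eq:
  "homologous P D n = {(x, y). x \<in> cycles P D n \<and> y \<in> cycles P D n \<and> \<epsilon> n x = \<epsilon> n y}"
proof (cases "n = 0")
  case True
  have "x - y \<in> D (Suc 0) ` P (Suc 0) \<longleftrightarrow> \<epsilon> 0 x = \<epsilon> 0 y" if "x \<in> P 0" "y \<in> P 0" for x y
    using admissible_exact_0[OF adm P_closed(3)[OF that]]
    by (simp add: augmentation_def lookup_minus pi_diff)
  then show ?thesis by (auto simp: homologous_def cycles_0 True)
next
  case False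
  then have "x - y \<in> D (Suc n) ` P (Suc n)" if "x \<in> cycles P D n" "y \<in> cycles P D n" for x y
    using that linear_on_diff[OF admissible_linear[OF adm, of n n, unfolded P_part_free], of x y]
    by (intro admissible_exact[OF adm] P_closed(3)) (auto simp: cycles_def P_part_free)
  then show ?thesis using False by (auto simp: homologous_def augmentation_def)
qed

lemma augmentation_scalar: "\<epsilon> 0 (sym_scalar c) = \<pi> c"
  by (simp add: augmentation_def sym_scalar_def)

lemma augmentation_image: "\<epsilon> n ` cycles P D n = conc n"
proof (cases "n = 0")
  case True
  have "\<epsilon> 0 ` P 0 = range \<pi>"
    unfolding P_part_0 image_image augmentation_scalar ..
  then show ?thesis using pi_surj by (simp add: True cycles_0 conc_def)
next
  case False
  have "0 \<in> cycles P D n" using D_zero P_closed(1) by (simp add: cycles_def)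
  then show ?thesis using False by (auto simp: augmentation_def conc_def)
qed

lemma homology_bij:
  "bij_betw (image (\<epsilon> n)) (homology P D n) (homology conc (\<lambda>_ _. 0) n)"
  "x \<in> cycles P D n \<Longrightarrow>
    \<epsilon> n ` homology_class P D n x = homology_class conc (\<lambda>_ _. 0) n (\<epsilon> n x)"
proof -
  show "bij_betw (image (\<epsilon> n)) (homology P D n) (homology conc (\<lambda>_ _. 0) n)"
    using bij_betw_image_quotient(1)[OF homologous_eq]
    by (simp add: homology_def[of P] augmentation_image homology_conc(3))
  assume x: "x \<in> cycles P D n"
  then have "\<epsilon> n x \<in> conc n" using augmentation_image by blast
  then show "\<epsilon> n ` homology_class P D n x = homology_class conc (\<lambda>_ _. 0) n (\<epsilon> n x)"
    using bij_betw_image_quotient(2)[OF homologous_eq x]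
    by (auto simp: homology_class_def homology_conc(2))
qed

lemma quasi_iso_augmentation: "quasi_iso P D conc (\<lambda>_ _. 0) \<epsilon>"
proof -
  have "\<epsilon> n x \<in> conc n" for n x
    by (simp add: augmentation_def conc_def)
  moreover have "\<epsilon> n (x + y) = \<epsilon> n x + \<epsilon> n y" for n x y
    by (simp add: augmentation_def lookup_add pi_add)
  moreover have "\<epsilon> n (D (Suc n) x) = 0" if x: "x \<in> P (Suc n)" for n x
  proof (cases "n = 0")
    case True
    then have "D 1 x \<in> P 0" using linear_on_in[OF admissible_linear[OF adm, of 1 1]] x by simp
    then show ?thesis
      using admissible_exact_0[OF adm] x True by (simp add: augmentation_def)
  qed (simp add: augmentation_def)
  moreover have "\<exists>\<phi>. bij_betw \<phi> (homology P D n) (homology conc (\<lambda>_ _. 0) n) \<and>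
      (\<forall>x\<in>cycles P D n. \<phi> (homology_class P D n x) = homology_class conc (\<lambda>_ _. 0) n (\<epsilon> n x))" for n
    by (intro exI[of _ "image (\<epsilon> n)"] conjI ballI homology_bij)
  ultimately show ?thesis
    unfolding quasi_iso_def by (intro conjI allI ballI)
qed

lemma koszul_tate:
  assumes "polynomial_ring \<kappa>' X"
  shows "koszul_tate_resolution \<kappa>' X \<pi> gdeg r P D"
proof -
  have "\<epsilon> 0 (x \<star> y) = \<epsilon> 0 x * \<epsilon> 0 y" if "x \<in> P 0" "y \<in> P 0" for x y
    using that unfolding P_part_0
    by (auto simp: augmentation_def sym_scalar_def mul_single pi_mult)
  moreover have "\<exists>G. (\<forall>g\<in>G. 0 < gdeg g) \<and> (\<forall>n. P n = sym_part gdeg G n)"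
    using all_gens_gdeg(1) P_part_eq by blast
  ultimately show ?thesis
    using assms cdga_admissible[OF adm] quasi_iso_augmentation augmentation_scalar
    by (simp add: koszul_tate_resolution_def)
qed

lemma homology_0:
  "\<exists>\<phi>. bij_betw \<phi> (homology P D 0) UNIV \<and> (\<forall>c. \<phi> (homology_class P D 0 (sym_scalar c)) = \<pi> c)"
proof (intro exI conjI allI)
  \<comment> \<open>\<open>the_elem\<close> unpacks the singletons that make up the homology of
    \<open>conc\<close>.\<close>
  have "bij_betw the_elem ((\<lambda>y. {y}) ` (UNIV :: 's set)) UNIV"
    by (auto simp: bij_betw_def inj_on_def image_image)
  then show "bij_betw (the_elem \<circ> image (\<epsilon> 0)) (homology P D 0) UNIV"
    using homology_bij(1)[of 0] by (intro bij_betw_trans) (simp_all add: homology_conc(3) conc_def)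
  fix c
  have "sym_scalar c \<in> cycles P D 0" by (simp add: cycles_0 P_part_0)
  then show "(the_elem \<circ> image (\<epsilon> 0)) (homology_class P D 0 (sym_scalar c)) = \<pi> c"
    using bij_betw_image_quotient(2)[OF homologous_eq, of "sym_scalar c" 0] augmentation_scalar
    by (simp add: homology_class_def)
qed

lemma homology_pos:
  assumes "1 \<le> k"
  shows "homology P D k = {homology_class P D k 0}"
proof -
  have 0: "0 \<in> cycles P D k" using D_zero P_closed(1) by (simp add: cycles_def)
  have "homologous P D k = cycles P D k \<times> cycles P D k"
    using assms by (auto simp: homologous_eq augmentation_def)
  with 0 show ?thesis by (auto simp: homology_def homology_class_def quotient_def)
qed

end

theorem theorem2p7:
  fixes \<kappa> :: "'k::field_char_0 \<Rightarrow> 'r::comm_ring_1"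
    and X :: "'r set"
    and \<pi> :: "'r \<Rightarrow> 's::comm_ring"
    and B :: "nat \<Rightarrow> 'b set"
    and e0 :: 'b
    and d :: "nat \<Rightarrow> ('b \<Rightarrow>\<^sub>0 'r) \<Rightarrow> ('b \<Rightarrow>\<^sub>0 'r)"
    and r :: "'b gen rel"
  assumes "polynomial_ring \<kappa> X"
    and "quotient_map \<pi>"
    and "free_resolution B e0 d \<pi>"
    and "finite {j. B j \<noteq> {}}"
    and "strict_linear_order r"
  shows
    "(\<exists>D \<rho> \<alpha> \<beta> \<gamma>. differential_upto B d r 1 D \<rho> \<alpha> \<beta> \<gamma>) \<and>
     (\<forall>i\<ge>1. \<forall>D \<rho> \<alpha> \<beta> \<gamma>. differential_upto B d r i D \<rho> \<alpha> \<beta> \<gamma> \<longrightarrow>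
        (\<exists>\<rho>'. rho_lift B d i \<rho> \<alpha> \<gamma> \<rho>') \<and>
        (\<forall>\<rho>'. rho_lift B d i \<rho> \<alpha> \<gamma> \<rho>' \<longrightarrow>
           (\<exists>!D'. D' \<in> P_part B (Suc i) \<rightarrow>\<^sub>E P_part B i \<and> next_differential B d r i D \<gamma> \<rho>' D')) \<and>
        (\<exists>D'. inductive_differential B d r D' \<and> (\<forall>j\<le>i. \<forall>x\<in>P_part B j. D' j x = D j x))) \<and>
     (\<forall>D. inductive_differential B d r D \<longrightarrow>
        koszul_tate_resolution \<kappa> X \<pi> gdeg r (P_part B) D \<and>
        (\<exists>\<phi>. bij_betw \<phi> (homology (P_part B) D 0) UNIV \<and>
           (\<forall>c. \<phi> (homology_class (P_part B) D 0 (sym_scalar c)) = \<pi> c)) \<and>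
        (\<forall>k\<ge>1. homology (P_part B) D k = {homology_class (P_part B) D k 0}))"
proof -
  interpret free_res r B e0 d \<pi>
    using assms by unfold_locales
  have "\<exists>D \<rho> \<alpha> \<beta> \<gamma>. differential_upto B d r 1 D \<rho> \<alpha> \<beta> \<gamma>"
    using ex_admissible_1 admissible_differential_upto by blast
  moreover have "(\<exists>\<rho>'. rho_lift B d i \<rho> \<alpha> \<gamma> \<rho>') \<and>
      (\<forall>\<rho>'. rho_lift B d i \<rho> \<alpha> \<gamma> \<rho>' \<longrightarrow>
         (\<exists>!D'. D' \<in> P (Suc i) \<rightarrow>\<^sub>E P i \<and> next_differential B d r i D \<gamma> \<rho>' D')) \<and>
      (\<exists>D'. inductive_differential B d r D' \<and> (\<forall>j\<le>i. \<forall>x\<in>P j. D' j x = D j x))"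
    if i: "1 \<le> i" and D: "differential_upto B d r i D \<rho> \<alpha> \<beta> \<gamma>" for i D \<rho> \<alpha> \<beta> \<gamma>
  proof -
    note adm = differential_upto_admissible[OF D]
    note entries = differential_upto_entries[OF D order_refl]
    have \<gamma>_in: "gamma_of D i u \<in> Old (i - 1)" if "u \<in> Old i" for u
      using linear_on_in[OF gamma_of_linear[OF adm] that] .
    \<comment> \<open>The hypothesis comes with arbitrary entries, whereas the preceding lemmas
      speak of those read off from \<open>D\<close>. The two agree on the old parts, and
      \<open>rho_lift\<close> and \<open>next_differential\<close> evaluate them only there.\<close>
    have "rho_lift B d i \<rho> \<alpha> \<gamma> = rho_lift B d i (rho_of D) (alpha_of D) (gamma_of D)"
      using i entries \<gamma>_in by (intro ext) (simp add: rho_lift_def)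
    moreover have "next_differential B d r i D \<gamma> = next_differential B d r i D (gamma_of D)"
      using entries(3) by (intro ext) (simp add: next_differential_def form_A_def)
    moreover have "\<exists>D'. inductive_differential B d r D' \<and> (\<forall>j\<le>i. \<forall>x\<in>P j. D' j x = D j x)"
      using ex_admissible_extension[OF adm] admissible_inductive by metis
    moreover have "\<exists>!D'. D' \<in> P (Suc i) \<rightarrow>\<^sub>E P i \<and> next_differential B d r i D (gamma_of D) \<rho>' D'"
      if "rho_lift B d i (rho_of D) (alpha_of D) (gamma_of D) \<rho>'" for \<rho>'
      using that by (intro ex1_next_differential[OF adm]) (auto simp: rho_lift_def)
    ultimately show ?thesis
      using ex_rho_lift[OF adm i] by simp
  qed
  moreover have "koszul_tate_resolution \<kappa> X \<pi> gdeg r P D \<and>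
      (\<exists>\<phi>. bij_betw \<phi> (homology P D 0) UNIV \<and>
         (\<forall>c. \<phi> (homology_class P D 0 (sym_scalar c)) = \<pi> c)) \<and>
      (\<forall>k\<ge>1. homology P D k = {homology_class P D k 0})"
    if "inductive_differential B d r D" for D
  proof -
    interpret quotient_res r B e0 d \<pi> D
      using assms that by unfold_locales
    show ?thesis
      by (intro conjI allI impI koszul_tate[OF assms(1)] homology_0 homology_pos)
  qed
  ultimately show ?thesis by (intro conjI allI impI) simp_all
qed

end
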